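(* For every positive integer $r$ and every integer $k \ge r + 1$, there exist infinitely many (pairwise non-isomorphic) nut graphs $G$ with $o_v(G) = r$ and $o_e(G) = k$.
   Context: All graphs are finite, simple and undirected. A nut graph is a graph with at least two vertices whose adjacency matrix has a one-dimensional null space spanned by a vector with no zero entries. For a graph $G$, $o_v(G)$ and $o_e(G)$ denote the number of orbits of the automorphism group $\mathrm{Aut}\,G$ on the vertex set and on the edge set, respectively. *)

theory Defs
  imports
    "Jordan_Normal_Form.Matrix_Kernel"
    "HOL-Algebra.Bij"
    "HOL-Algebra.Group_Action"
begin

record 'a ugraph =
  vertices :: "'a set"
  edges :: "'a set set"

definition simple_graph :: "'a ugraph \<Rightarrow> bool" where
  "simple_graph G \<longleftrightarrow>
     finite (vertices G) \<and> (\<forall>e \<in> edges G. e \<subseteq> vertices G \<and> card e = 2)"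

text \<open>
  The vertices are enumerated in increasing order; another enumeration would conjugate the
  matrix by a permutation matrix, which merely permutes the entries of null vectors.
\<close>

definition adjacency_matrix :: "'a::linorder ugraph \<Rightarrow> real mat" where
  "adjacency_matrix G =
     (let n = card (vertices G); vs = sorted_list_of_set (vertices G)
      in mat n n (\<lambda>(i, j). if {vs ! i, vs ! j} \<in> edges G then 1 else 0))"

definition nut_graph :: "'a::linorder ugraph \<Rightarrow> bool" where
  "nut_graph G \<longleftrightarrow>
     simple_graph G \<and> card (vertices G) \<ge> 2 \<and>
     kernel_dim (adjacency_matrix G) = 1 \<and>
     (\<exists>x \<in> carrier_vec (card (vertices G)).
        mat_kernel (adjacency_matrix G) =
          LinearCombinations.module.span class_ring
            (module_vec TYPE(real) (card (vertices G))) {x} \<and>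
        (\<forall>i < card (vertices G). x $ i \<noteq> 0))"

definition graph_iso :: "'a ugraph \<Rightarrow> 'b ugraph \<Rightarrow> ('a \<Rightarrow> 'b) \<Rightarrow> bool" where
  "graph_iso G H f \<longleftrightarrow>
     bij_betw f (vertices G) (vertices H) \<and>
     (\<forall>u \<in> vertices G. \<forall>v \<in> vertices G. {u, v} \<in> edges G \<longleftrightarrow> {f u, f v} \<in> edges H)"

definition isomorphic :: "'a ugraph \<Rightarrow> 'b ugraph \<Rightarrow> bool" where
  "isomorphic G H \<longleftrightarrow> (\<exists>f. graph_iso G H f)"

definition Aut :: "'a ugraph \<Rightarrow> ('a \<Rightarrow> 'a) monoid" where
  "Aut G = (BijGroup (vertices G)) \<lparr>carrier := {f \<in> Bij (vertices G). graph_iso G G f}\<rparr>"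

definition num_vertex_orbits :: "'a ugraph \<Rightarrow> nat" where
  "num_vertex_orbits G = card (orbits (Aut G) (vertices G) (\<lambda>f v. f v))"

definition num_edge_orbits :: "'a ugraph \<Rightarrow> nat" where
  "num_edge_orbits G = card (orbits (Aut G) (edges G) (\<lambda>f e. f ` e))"

end

(* Let H be the Hamming graph K_{n_1} x ... x K_{n_j} (Cartesian product) with j = k - r and distinct
   n_i > max(j, 3); it is d-regular, vertex-transitive and nonsingular, d is a simple eigenvalue and
   -d is not one, and its j edge orbits are told apart by the number n_i - 2 of common neighbours.
   Take the Cartesian product of H with K_{d,d} and subdivide every edge coming from K_{d,d} by
   2(r - 1) vertices. On null vectors each subdivided edge acts like an edge of weight (-1)^(r - 1),
   so a null vector gives functions g_0, g_1 on H (nonsingularity removes the dependence on the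
   position in K_{d,d}) with A g_0 = e d g_1 and A g_1 = e d g_0 for a sign e. Then g_0 - e g_1 is an
   eigenvector for -d, hence 0, and g_0 is one for d, hence constant: the graph is a nut graph.
   The distance to the branch vertices gives r vertex orbits, and the subdivided paths contribute r
   further edge orbits. *)

theory Submission
  imports Defs "HOL-Combinatorics.Transposition"
begin

section \<open>Adjacency and nut graphs in functional form\<close>

text \<open>Up to the signs of the paths, the kernel sees the sums \<lambda> + \<mu> of an
  eigenvalue \<lambda> of H and an eigenvalue \<mu> of K_{d,d}, and \<mu> is one of d, 0, -d. Giving
  H and K_{d,d} the same degree d leaves a single way to reach 0: \<lambda> = 0 and \<lambda> = -d
  are excluded, and \<lambda> = d is simple with constant eigenvector, so the kernel is a line
  without zero entries. The eigenvalues of H are -j plus the sum of n_i over i in S, one for each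
  set S of directions. The empty S gives -j, which is above -d; every other S gives a positive
  number because n_i > j; only the full S gives d. The proof never diagonalises: positivity of one
  summand per direction, together with a maximum principle, yields the three facts. A path with 2m
  inner vertices has 2m + 1 edges. Reversal folds them into m + 1 classes, as many as there are
  depths 0, ..., m. The n_i may be arbitrarily large, whence infinitely many examples.\<close>

definition nbrs :: "'a ugraph \<Rightarrow> 'a \<Rightarrow> 'a set" where
  "nbrs G v = {u \<in> vertices G. {v, u} \<in> edges G}"

definition null_fun :: "'a ugraph \<Rightarrow> ('a \<Rightarrow> real) \<Rightarrow> bool" where
  "null_fun G f \<longleftrightarrow> (\<forall>v \<in> vertices G. (\<Sum>u \<in> nbrs G v. f u) = 0)"

text \<open>Proportionality is asked for on \<open>vertices G\<close> only, since
  \<open>null_fun\<close> sees no other values of \<open>f\<close>.\<close>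

definition nut_fun :: "'a ugraph \<Rightarrow> ('a \<Rightarrow> real) \<Rightarrow> bool" where
  "nut_fun G w \<longleftrightarrow> null_fun G w \<and> (\<forall>v \<in> vertices G. w v \<noteq> 0) \<and>
     (\<forall>f. null_fun G f \<longrightarrow> (\<exists>c. \<forall>v \<in> vertices G. f v = c * w v))"

text \<open>The bridge from matrices to functions: \<open>enc\<close> lists the values of a function
  in the order of \<open>vs\<close>, and row \<open>i\<close> of the adjacency matrix then sums over
  the neighbours of \<open>vs ! i\<close>. The kernel becomes the set of multiples of
  \<open>enc w\<close>, which is the span of one nonzero vector.\<close>

lemma nut_graphI:
  fixes G :: "'a::linorder ugraph"
  assumes simple: "simple_graph G" and card: "card (vertices G) \<ge> 2" and w: "nut_fun G w"
  shows "nut_graph G"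
proof -
  let ?n = "card (vertices G)"
  define vs where "vs = sorted_list_of_set (vertices G)"
  let ?A = "adjacency_matrix G"
  have fin: "finite (vertices G)" using simple by (simp add: simple_graph_def)
  have bij: "bij_betw ((!) vs) {..<?n} (vertices G)"
    by (rule bij_betw_nth) (simp_all add: vs_def fin)
  have vs_in: "vs ! i \<in> vertices G" if "i < ?n" for i
    using bij that by (auto simp: bij_betw_def)
  have A_def: "?A = mat ?n ?n (\<lambda>(i, j). if {vs ! i, vs ! j} \<in> edges G then 1 else 0)"
    by (simp add: adjacency_matrix_def Let_def vs_def)
  have A: "?A \<in> carrier_mat ?n ?n" by (simp add: A_def)
  define enc where "enc f = vec ?n (\<lambda>i. f (vs ! i))" for f :: "'a \<Rightarrow> real"
  have mult_enc: "(?A *\<^sub>v enc f) $ i = (\<Sum>u \<in> nbrs G (vs ! i). f u)" if "i < ?n" for f i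
  proof -
    have "(?A *\<^sub>v enc f) $ i =
        (\<Sum>j \<in> {..<?n}. (if {vs ! i, vs ! j} \<in> edges G then f (vs ! j) else 0))"
      using that by (auto simp: A_def enc_def scalar_prod_def lessThan_atLeast0 intro!: sum.cong)
    also have "\<dots> = (\<Sum>u \<in> vertices G. if {vs ! i, u} \<in> edges G then f u else 0)"
      using sum.reindex_bij_betw[OF bij] by fastforce
    also have "\<dots> = (\<Sum>u \<in> nbrs G (vs ! i). f u)"
      using fin by (simp add: nbrs_def sum.inter_filter)
    finally show ?thesis .
  qed
  have enc_ker: "enc f \<in> mat_kernel ?A \<longleftrightarrow> null_fun G f" for f
  proof -
    have "enc f \<in> mat_kernel ?A \<longleftrightarrow> ?A *\<^sub>v enc f = 0\<^sub>v ?n"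
      by (simp add: mat_kernel[OF A] enc_def)
    also have "\<dots> \<longleftrightarrow> (\<forall>i < ?n. (?A *\<^sub>v enc f) $ i = 0)"
      unfolding vec_eq_iff using A by (simp del: index_mult_mat_vec)
    also have "\<dots> \<longleftrightarrow> (\<forall>i < ?n. (\<Sum>u \<in> nbrs G (vs ! i). f u) = 0)"
      using mult_enc by auto
    also have "\<dots> \<longleftrightarrow> null_fun G f"
      unfolding null_fun_def using bij by (metis bij_betw_def imageE image_eqI lessThan_iff)
    finally show ?thesis .
  qed
  have enc_surj: "\<exists>f. y = enc f" if "y \<in> carrier_vec ?n" for y
  proof
    show "y = enc (\<lambda>u. y $ (inv_into {..<?n} ((!) vs) u))"
      using that bij by (auto simp: enc_def bij_betw_def intro!: eq_vecI)
  qed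
  have ker: "mat_kernel ?A = {c \<cdot>\<^sub>v enc w | c. True}"
  proof safe
    fix y assume y: "y \<in> mat_kernel ?A"
    then obtain f where f: "y = enc f" using enc_surj mat_kernelD(1)[OF A] by blast
    then obtain c where "\<forall>v \<in> vertices G. f v = c * w v"
      using y enc_ker w unfolding nut_fun_def by meson
    then have "y = c \<cdot>\<^sub>v enc w"
      using vs_in by (auto simp: f enc_def intro!: eq_vecI)
    then show "\<exists>c. y = c \<cdot>\<^sub>v enc w \<and> True" by blast
  next
    fix c show "c \<cdot>\<^sub>v enc w \<in> mat_kernel ?A"
      using mat_kernel_smult[OF A] enc_ker w by (simp add: nut_fun_def)
  qed
  interpret K: kernel ?n ?n ?A by standard (rule A)
  have ew: "enc w \<in> carrier_vec ?n" by (simp add: enc_def)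
  have ewk: "{enc w} \<subseteq> mat_kernel ?A" using enc_ker w by (simp add: nut_fun_def)
  have span: "K.NC.span {enc w} = {c \<cdot>\<^sub>v enc w | c. True}"
  proof -
    have "K.NC.span {enc w} = range (\<lambda>a. K.NC.lincomb a {enc w})"
      using K.NC.finite_span[of "{enc w}"] ew by auto
    moreover have "K.NC.lincomb a {enc w} = a (enc w) \<cdot>\<^sub>v enc w" for a
      using ew by (simp add: K.NC.lincomb_def K.NC.M.finsum_insert)
    ultimately show ?thesis
      by auto
  qed
  have nz: "enc w $ i \<noteq> 0" if "i < ?n" for i
    using that w vs_in by (auto simp: enc_def nut_fun_def)
  have "0 < ?n" using card by simp
  then have "enc w \<noteq> 0\<^sub>v ?n" using nz[of 0] by auto
  then have "kernel_dim ?A = 1"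
    using K.Ker.dim1I[of "enc w"] K.span_same[OF ewk] span ker ewk by simp
  moreover have "mat_kernel ?A = K.NC.span {enc w}" using ker span by simp
  ultimately show ?thesis
    unfolding nut_graph_def using simple card ew nz by blast
qed

section \<open>Isomorphisms and orbits\<close>

lemma graph_iso_comp:
  assumes "graph_iso G H f" "graph_iso H K g"
  shows "graph_iso G K (g \<circ> f)"
  using assms by (auto simp: graph_iso_def bij_betw_trans dest: bij_betwE)

lemma graph_iso_vertex:
  "graph_iso G H f \<Longrightarrow> v \<in> vertices G \<Longrightarrow> f v \<in> vertices H"
  by (auto simp: graph_iso_def dest: bij_betwE)

lemma graph_iso_inv_into_left:
  "graph_iso G H f \<Longrightarrow> v \<in> vertices G \<Longrightarrow> inv_into (vertices G) f (f v) = v"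
  by (auto simp: graph_iso_def intro: bij_betw_inv_into_left)

lemma graph_iso_inv_into_right:
  "graph_iso G H f \<Longrightarrow> v \<in> vertices H \<Longrightarrow> f (inv_into (vertices G) f v) = v"
  by (auto simp: graph_iso_def intro: bij_betw_inv_into_right)

lemma graph_iso_inv_into:
  assumes "graph_iso G H f"
  shows "graph_iso H G (inv_into (vertices G) f)"
proof -
  have bij: "bij_betw (inv_into (vertices G) f) (vertices H) (vertices G)"
    using assms by (simp add: graph_iso_def bij_betw_inv_into)
  then have "{u, v} \<in> edges H \<longleftrightarrow> {inv_into (vertices G) f u, inv_into (vertices G) f v} \<in> edges G"
    if "u \<in> vertices H" "v \<in> vertices H" for u v
    using that assms graph_iso_inv_into_right[OF assms] by (auto simp: graph_iso_def dest!: bij_betwE)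
  with bij show ?thesis by (simp add: graph_iso_def)
qed

lemma graph_iso_restrict:
  "graph_iso G H (restrict f (vertices G)) \<longleftrightarrow> graph_iso G H f"
  by (simp add: graph_iso_def)

lemma simple_graph_edgeE:
  assumes "simple_graph G" "e \<in> edges G"
  obtains u v where "e = {u, v}" "u \<in> vertices G" "v \<in> vertices G" "u \<noteq> v"
  using assms by (auto simp: simple_graph_def card_2_iff)

lemma graph_iso_image_edge:
  assumes "simple_graph G" "graph_iso G H f" "e \<in> edges G"
  shows "f ` e \<in> edges H"
  using assms(1,3) by (rule simple_graph_edgeE) (use assms(2,3) in \<open>auto simp: graph_iso_def\<close>)

lemma graph_iso_image_nbrs:
  assumes "graph_iso G H f" "v \<in> vertices G"
  shows "nbrs H (f v) = f ` nbrs G v"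
proof -
  have "{f v, f u} \<in> edges H \<longleftrightarrow> {v, u} \<in> edges G" if "u \<in> vertices G" for u
    using assms that by (simp add: graph_iso_def)
  moreover have "vertices H = f ` vertices G"
    using assms(1) by (simp add: graph_iso_def bij_betw_def)
  ultimately show ?thesis by (auto simp: nbrs_def)
qed

text \<open>Finiteness supplies the converse on edges: the induced map on the finite edge set is
  injective, hence onto, so an edge between images comes from an edge, and injectivity on vertices
  identifies it.\<close>

lemma graph_isoI:
  assumes "simple_graph G" "f ` vertices G \<subseteq> vertices G" "inj_on f (vertices G)"
    and "\<And>u v. u \<in> vertices G \<Longrightarrow> v \<in> vertices G \<Longrightarrow> {u, v} \<in> edges G \<Longrightarrow> {f u, f v} \<in> edges G"
  shows "graph_iso G G f"
proof -
  have fin: "finite (vertices G)" and sub: "edges G \<subseteq> Pow (vertices G)"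
    using assms(1) by (auto simp: simple_graph_def)
  have inj: "inj_on ((`) f) (edges G)"
    using inj_on_image_Pow[OF assms(3)] sub by (rule inj_on_subset)
  have "(`) f ` edges G \<subseteq> edges G"
  proof (intro image_subsetI)
    fix e assume e: "e \<in> edges G"
    obtain u v where "e = {u, v}" "u \<in> vertices G" "v \<in> vertices G"
      using simple_graph_edgeE[OF assms(1) e] by blast
    then show "f ` e \<in> edges G" using assms(4) e by simp
  qed
  then have surj: "(`) f ` edges G = edges G"
    using endo_inj_surj[OF finite_subset[OF sub]] fin inj by simp
  have "{u, v} \<in> edges G" if uv: "u \<in> vertices G" "v \<in> vertices G" and "{f u, f v} \<in> edges G" for u v
  proof -
    from that surj obtain e where e: "e \<in> edges G" "f ` e = {f u, f v}"
      by (metis (mono_tags, lifting) imageE)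
    then have "e = {u, v}"
      using inj_on_image_eq_iff[OF assms(3), of e "{u, v}"] sub uv by auto
    with e show ?thesis by simp
  qed
  moreover have "bij_betw f (vertices G) (vertices G)"
    using endo_inj_surj[OF fin assms(2,3)] assms(3) by (simp add: bij_betw_def)
  ultimately show ?thesis
    using assms(4) by (auto simp: graph_iso_def)
qed

lemma carrier_Aut: "carrier (Aut G) = {f \<in> Bij (vertices G). graph_iso G G f}"
  by (simp add: Aut_def)

text \<open>Members of \<open>Bij\<close> are extensional, so a map that acts as an automorphism
  enters the group only after restriction.\<close>

lemma restrict_in_Aut:
  assumes "graph_iso G G f"
  shows "restrict f (vertices G) \<in> carrier (Aut G)"
  using assms by (simp add: carrier_Aut Bij_def graph_iso_restrict) (simp add: graph_iso_def)

text \<open>A complete invariant \<open>I\<close> turns orbits into its fibres, so counting orbits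
  becomes counting values.\<close>

lemma card_orbits:
  assumes "\<And>g x. g \<in> carrier A \<Longrightarrow> x \<in> X \<Longrightarrow> \<phi> g x \<in> X"
    and "\<And>x y. x \<in> X \<Longrightarrow> y \<in> X \<Longrightarrow> (\<exists>g \<in> carrier A. \<phi> g x = y) \<longleftrightarrow> I x = I y"
  shows "card (orbits A X \<phi>) = card (I ` X)"
proof -
  have "orbit A \<phi> x = {y \<in> X. I y = I x}" if "x \<in> X" for x
    unfolding orbit_def using that assms(1) assms(2)[OF that] by (auto; metis)
  then have "orbits A X \<phi> = (\<lambda>c. {y \<in> X. I y = c}) ` I ` X"
    by (force simp: orbits_def)
  moreover have "inj_on (\<lambda>c. {y \<in> X. I y = c}) (I ` X)"
    by (auto simp: inj_on_def)
  ultimately show ?thesis by (simp add: card_image)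
qed

text \<open>Invariants are computed on the structured graph \<open>G\<close>, orbits are counted on
  its relabelled copy \<open>H\<close>; conjugation by \<open>h\<close> carries automorphisms
  across.\<close>

lemma num_vertex_orbits_eq:
  assumes h: "graph_iso G H h"
    and I: "\<And>u v. u \<in> vertices G \<Longrightarrow> v \<in> vertices G \<Longrightarrow>
      (\<exists>g. graph_iso G G g \<and> g u = v) \<longleftrightarrow> I u = I v"
  shows "num_vertex_orbits H = card (I ` vertices G)"
proof -
  define k where "k = inv_into (vertices G) h"
  have k: "graph_iso H G k" unfolding k_def by (rule graph_iso_inv_into[OF h])
  have kV: "k ` vertices H = vertices G" using k by (simp add: graph_iso_def bij_betw_def)
  have hk: "h (k x) = x" if "x \<in> vertices H" for x
    using that h by (simp add: k_def graph_iso_inv_into_right)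
  have kh: "k (h x) = x" if "x \<in> vertices G" for x
    using that h by (simp add: k_def graph_iso_inv_into_left)
  have "num_vertex_orbits H = card ((I \<circ> k) ` vertices H)"
    unfolding num_vertex_orbits_def
  proof (rule card_orbits)
    fix g x assume "g \<in> carrier (Aut H)" "x \<in> vertices H"
    then show "g x \<in> vertices H" by (auto simp: carrier_Aut graph_iso_def dest: bij_betwE)
  next
    fix x y assume x: "x \<in> vertices H" and y: "y \<in> vertices H"
    have "(\<exists>g \<in> carrier (Aut H). g x = y) \<longleftrightarrow> (\<exists>g. graph_iso G G g \<and> g (k x) = k y)"
    proof safe
      fix g assume "g \<in> carrier (Aut H)"
      then have "graph_iso G G (k \<circ> (g \<circ> h))"
        using h k by (auto simp: carrier_Aut intro!: graph_iso_comp)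
      then show "\<exists>g'. graph_iso G G g' \<and> g' (k x) = k (g x)"
        using hk[OF x] by (intro exI[of _ "k \<circ> (g \<circ> h)"]) simp
    next
      fix g assume g: "graph_iso G G g" "g (k x) = k y"
      then have "graph_iso H H (h \<circ> (g \<circ> k))"
        using h k by (auto intro!: graph_iso_comp)
      then show "\<exists>g' \<in> carrier (Aut H). g' x = y"
        using g(2) x hk[OF y] by (intro bexI[OF _ restrict_in_Aut]) auto
    qed
    also have "\<dots> \<longleftrightarrow> I (k x) = I (k y)"
      using x y kV by (intro I) auto
    finally show "(\<exists>g \<in> carrier (Aut H). g x = y) \<longleftrightarrow> (I \<circ> k) x = (I \<circ> k) y" by simp
  qed
  then show ?thesis by (metis image_comp kV)
qed

lemma num_edge_orbits_eq:
  assumes G: "simple_graph G" and H: "simple_graph H" and h: "graph_iso G H h"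
    and I: "\<And>d e. d \<in> edges G \<Longrightarrow> e \<in> edges G \<Longrightarrow>
      (\<exists>g. graph_iso G G g \<and> g ` d = e) \<longleftrightarrow> I d = I e"
  shows "num_edge_orbits H = card (I ` edges G)"
proof -
  define k where "k = inv_into (vertices G) h"
  have k: "graph_iso H G k" unfolding k_def by (rule graph_iso_inv_into[OF h])
  have sub: "x \<subseteq> vertices H" if "x \<in> edges H" for x
    using that H by (simp add: simple_graph_def)
  have subG: "x \<subseteq> vertices G" if "x \<in> edges G" for x
    using that G by (simp add: simple_graph_def)
  have hk: "h ` k ` x = x" if "x \<subseteq> vertices H" for x
    using that h unfolding k_def
    by (simp add: image_image graph_iso_inv_into_right subset_iff)
  have kh: "k ` h ` x = x" if "x \<subseteq> vertices G" for x
    using that h unfolding k_def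
    by (simp add: image_image graph_iso_inv_into_left subset_iff)
  have kE: "(`) k ` edges H = edges G"
  proof
    show "(`) k ` edges H \<subseteq> edges G" using graph_iso_image_edge[OF H k] by auto
    show "edges G \<subseteq> (`) k ` edges H"
    proof
      fix e assume e: "e \<in> edges G"
      then have "h ` e \<in> edges H" by (rule graph_iso_image_edge[OF G h])
      then show "e \<in> (`) k ` edges H"
        using kh[OF subG[OF e]] by (metis imageI)
    qed
  qed
  have "num_edge_orbits H = card ((I \<circ> (`) k) ` edges H)"
    unfolding num_edge_orbits_def
  proof (rule card_orbits)
    fix g x assume "g \<in> carrier (Aut H)" "x \<in> edges H"
    then show "g ` x \<in> edges H" using graph_iso_image_edge[OF H] by (auto simp: carrier_Aut)
  next
    fix x y assume x: "x \<in> edges H" and y: "y \<in> edges H"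
    have "(\<exists>g \<in> carrier (Aut H). g ` x = y) \<longleftrightarrow> (\<exists>g. graph_iso G G g \<and> g ` k ` x = k ` y)"
    proof safe
      fix g assume "g \<in> carrier (Aut H)"
      then have "graph_iso G G (k \<circ> (g \<circ> h))"
        using h k by (auto simp: carrier_Aut intro!: graph_iso_comp)
      then show "\<exists>g'. graph_iso G G g' \<and> g' ` k ` x = k ` g ` x"
        using hk[OF sub[OF x]]
        by (intro exI[of _ "k \<circ> (g \<circ> h)"]) (metis image_comp)
    next
      fix g assume g: "graph_iso G G g" "g ` k ` x = k ` y"
      then have "graph_iso H H (h \<circ> (g \<circ> k))"
        using h k by (auto intro!: graph_iso_comp)
      moreover have "restrict (h \<circ> (g \<circ> k)) (vertices H) ` x = y"
      proof -
        have "restrict (h \<circ> (g \<circ> k)) (vertices H) ` x = h ` g ` k ` x"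
          using sub[OF x] by (auto simp: image_image subset_iff)
        then show ?thesis using g(2) hk[OF sub[OF y]] by simp
      qed
      ultimately show "\<exists>g' \<in> carrier (Aut H). g' ` x = y"
        by (intro bexI[OF _ restrict_in_Aut])
    qed
    also have "\<dots> \<longleftrightarrow> I (k ` x) = I (k ` y)"
      using x y kE by (intro I) auto
    finally show "(\<exists>g \<in> carrier (Aut H). g ` x = y) \<longleftrightarrow> (I \<circ> (`) k) x = (I \<circ> (`) k) y" by simp
  qed
  then show ?thesis by (metis image_comp kE)
qed

section \<open>Transport of null vectors and relabelling by natural numbers\<close>

lemma null_fun_iso:
  assumes g: "graph_iso G H g" and f: "null_fun H f"
  shows "null_fun G (f \<circ> g)"
  unfolding null_fun_def
proof
  fix v assume v: "v \<in> vertices G"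
  have "inj_on g (nbrs G v)"
    using g by (auto simp: nbrs_def graph_iso_def bij_betw_def intro: inj_on_subset)
  then have "(\<Sum>u \<in> nbrs G v. (f \<circ> g) u) = (\<Sum>u \<in> nbrs H (g v). f u)"
    by (simp add: graph_iso_image_nbrs[OF g v] sum.reindex)
  also have "\<dots> = 0"
    using f graph_iso_vertex[OF g v] by (simp add: null_fun_def)
  finally show "(\<Sum>u \<in> nbrs G v. (f \<circ> g) u) = 0" .
qed

lemma nut_fun_iso:
  assumes h: "graph_iso G H h" and w: "nut_fun G w"
  shows "nut_fun H (w \<circ> inv_into (vertices G) h)"
proof -
  define k where "k = inv_into (vertices G) h"
  have k: "graph_iso H G k" unfolding k_def by (rule graph_iso_inv_into[OF h])
  have "\<exists>c. \<forall>v \<in> vertices H. f v = c * w (k v)" if "null_fun H f" for f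
  proof -
    have "null_fun G (f \<circ> h)" using null_fun_iso[OF h that] .
    then obtain c where c: "\<forall>v \<in> vertices G. (f \<circ> h) v = c * w v"
      using w unfolding nut_fun_def by meson
    have "f v = c * w (k v)" if "v \<in> vertices H" for v
    proof -
      have "k v \<in> vertices G" "h (k v) = v"
        using that h graph_iso_vertex[OF k] by (simp_all add: k_def graph_iso_inv_into_right)
      then show ?thesis using c by force
    qed
    then show ?thesis by blast
  qed
  moreover have "null_fun H (w \<circ> k)" using w by (intro null_fun_iso[OF k]) (simp add: nut_fun_def)
  moreover have "\<forall>v \<in> vertices H. w (k v) \<noteq> 0"
    using w k by (auto simp: nut_fun_def graph_iso_def dest: bij_betwE)
  ultimately show ?thesis by (auto simp: nut_fun_def k_def)
qed

text \<open>The construction lives on a datatype, whereas \<open>adjacency_matrix\<close> requires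
  linearly ordered vertices.\<close>

lemma simple_graph_relabel_nat:
  fixes G :: "'a ugraph"
  assumes "simple_graph G"
  obtains H :: "nat ugraph" and h where "simple_graph H" "graph_iso G H h"
proof -
  obtain h :: "'a \<Rightarrow> nat" where inj: "inj_on h (vertices G)"
    using assms finite_imp_inj_to_nat_seg[of "vertices G"] unfolding simple_graph_def by blast
  let ?H = "\<lparr>vertices = h ` vertices G, edges = (`) h ` edges G\<rparr>"
  have sub: "e \<subseteq> vertices G" "card e = 2" if "e \<in> edges G" for e
    using that assms by (auto simp: simple_graph_def)
  have "simple_graph ?H"
    using assms inj by (auto simp: simple_graph_def card_image inj_on_subset)
  moreover have "{u, v} \<in> edges G \<longleftrightarrow> {h u, h v} \<in> (`) h ` edges G"
    if "u \<in> vertices G" "v \<in> vertices G" for u v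
  proof
    assume "{u, v} \<in> edges G"
    then have "h ` {u, v} \<in> (`) h ` edges G" by (rule imageI)
    then show "{h u, h v} \<in> (`) h ` edges G" by simp
  next
    assume "{h u, h v} \<in> (`) h ` edges G"
    then obtain e where e: "e \<in> edges G" "h ` e = h ` {u, v}" by auto
    then have "e = {u, v}"
      using inj_on_image_eq_iff[OF inj, of e "{u, v}"] sub(1)[OF e(1)] that by simp
    with e(1) show "{u, v} \<in> edges G" by simp
  qed
  then have "graph_iso G ?H h" using inj by (simp add: graph_iso_def bij_betw_def)
  ultimately show ?thesis using that by blast
qed

text \<open>Order distinguishes isomorphism classes, so unboundedly large examples suffice.\<close>

lemma infinite_nonisomorphic_family:
  assumes "\<And>N. \<exists>G :: nat ugraph. P G \<and> simple_graph G \<and> card (vertices G) \<ge> N"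
  shows "\<exists>\<G> :: nat ugraph set. infinite \<G> \<and> pairwise (\<lambda>G H. \<not> isomorphic G H) \<G> \<and> (\<forall>G \<in> \<G>. P G)"
proof -
  define S where "S = (\<lambda>G :: nat ugraph. card (vertices G)) ` Collect P"
  have inf: "infinite S"
    unfolding infinite_nat_iff_unbounded_le S_def using assms by blast
  have "\<forall>s \<in> S. \<exists>G. P G \<and> card (vertices G) = s" by (auto simp: S_def)
  then obtain \<gamma> where \<gamma>: "\<And>s. s \<in> S \<Longrightarrow> P (\<gamma> s) \<and> card (vertices (\<gamma> s)) = s" by metis
  have "inj_on \<gamma> S" using \<gamma> by (metis inj_onI)
  then have "infinite (\<gamma> ` S)" using inf finite_imageD by blast
  moreover have "pairwise (\<lambda>G H. \<not> isomorphic G H) (\<gamma> ` S)"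
  proof (rule pairwiseI)
    fix G H assume "G \<in> \<gamma> ` S" "H \<in> \<gamma> ` S" "G \<noteq> H"
    then have "card (vertices G) \<noteq> card (vertices H)" using \<gamma> by auto
    then show "\<not> isomorphic G H"
      by (auto simp: isomorphic_def graph_iso_def dest: bij_betw_same_card)
  qed
  ultimately show ?thesis using \<gamma> by blast
qed

section \<open>Hamming graphs\<close>

text \<open>Taking a set of endpoints makes the count independent of an orientation of the
  edge.\<close>

definition triangles :: "'a ugraph \<Rightarrow> 'a set \<Rightarrow> nat" where
  "triangles G e = card {w \<in> vertices G. \<forall>v \<in> e. {v, w} \<in> edges G}"

lemma triangles_iso:
  assumes g: "graph_iso G G g" and e: "e \<subseteq> vertices G"
  shows "triangles G (g ` e) = triangles G e"
proof -
  have "{w \<in> vertices G. \<forall>v \<in> g ` e. {v, w} \<in> edges G} = g ` {w \<in> vertices G. \<forall>v \<in> e. {v, w} \<in> edges G}"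
    (is "?L = g ` ?R")
  proof -
    have "{g v, g w} \<in> edges G \<longleftrightarrow> {v, w} \<in> edges G" if "v \<in> e" "w \<in> vertices G" for v w
      using g e that by (auto simp: graph_iso_def)
    moreover have "g ` vertices G = vertices G"
      using g by (simp add: graph_iso_def bij_betw_def)
    ultimately show ?thesis by (auto simp: image_iff) (metis imageE)
  qed
  moreover have "inj_on g ?R"
    using g by (auto simp: graph_iso_def bij_betw_def intro: inj_on_subset)
  ultimately show ?thesis by (simp add: triangles_def card_image)
qed

lemma bij_betw_transpose_less:
  "a < m \<Longrightarrow> b < m \<Longrightarrow> bij_betw (transpose a b) {..<m} {..<m :: nat}"
  by (rule bij_betw_byWitness[where f' = "transpose a b"]) (auto simp: transpose_def)

text \<open>Here \<open>n_gt\<close> keeps 0 out of the spectrum, \<open>n_ge\<close> puts every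
  edge into a triangle and makes the degree at least 3, and \<open>n_inj\<close> lets triangle
  counts tell the directions apart.\<close>

locale hamming =
  fixes j :: nat and n :: "nat \<Rightarrow> nat"
  assumes j: "j \<ge> 1"
    and n_gt: "\<And>i. i < j \<Longrightarrow> n i > j"
    and n_ge: "\<And>i. i < j \<Longrightarrow> n i \<ge> 4"
    and n_inj: "inj_on n {..<j}"
begin

definition W :: "(nat \<Rightarrow> nat) set" where
  "W = (\<Pi>\<^sub>E i \<in> {..<j}. {..<n i})"

text \<open>The index \<open>i\<close> is the direction of the edge. Outside the coordinates below
  \<open>j\<close> both points are \<open>undefined\<close>, so letting \<open>l\<close> range over
  all numbers is harmless.\<close>

definition hadj :: "nat \<Rightarrow> (nat \<Rightarrow> nat) \<Rightarrow> (nat \<Rightarrow> nat) \<Rightarrow> bool" where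
  "hadj i x y \<longleftrightarrow> i < j \<and> x \<in> W \<and> y \<in> W \<and> x i \<noteq> y i \<and> (\<forall>l. l \<noteq> i \<longrightarrow> x l = y l)"

definition H :: "(nat \<Rightarrow> nat) ugraph" where
  "H = \<lparr>vertices = W, edges = {{x, y} | x y. \<exists>i. hadj i x y}\<rparr>"

definition d :: nat where
  "d = (\<Sum>i<j. n i - 1)"

text \<open>The adjacency operator is \<open>(\<Sum>i<j. J i) - j\<close>, where the \<open>J i\<close> commute and are positive
  semidefinite with \<open>J i (J i f) = n i * J i f\<close>; its spectrum is controlled through this.\<close>

definition J :: "nat \<Rightarrow> ((nat \<Rightarrow> nat) \<Rightarrow> real) \<Rightarrow> (nat \<Rightarrow> nat) \<Rightarrow> real" where
  "J i f x = (\<Sum>a<n i. f (x(i := a)))"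

lemma vertices_H [simp]: "vertices H = W"
  by (simp add: H_def)

lemma finite_W: "finite W"
  by (simp add: W_def finite_PiE)

lemma W_less: "x \<in> W \<Longrightarrow> i < j \<Longrightarrow> x i < n i"
  by (auto simp: W_def)

lemma W_upd: "x \<in> W \<Longrightarrow> i < j \<Longrightarrow> a < n i \<Longrightarrow> x(i := a) \<in> W"
  by (auto simp: W_def PiE_iff extensional_def)

lemma W_nonempty: "W \<noteq> {}"
  using n_ge by (fastforce simp: W_def PiE_eq_empty_iff lessThan_empty_iff)

lemma hadj_sym: "hadj i x y \<longleftrightarrow> hadj i y x"
  by (auto simp: hadj_def)

lemma edge_H_iff: "{x, y} \<in> edges H \<longleftrightarrow> (\<exists>i. hadj i x y)"
  using hadj_sym by (auto simp: H_def doubleton_eq_iff)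

lemma hadj_iff_upd:
  assumes "x \<in> W" "i < j"
  shows "hadj i x y \<longleftrightarrow> (\<exists>a. a < n i \<and> a \<noteq> x i \<and> y = x(i := a))"
proof
  assume "hadj i x y"
  then have "y = x(i := y i)" "y i < n i" "y i \<noteq> x i"
    using W_less by (auto simp: hadj_def)
  then show "\<exists>a. a < n i \<and> a \<noteq> x i \<and> y = x(i := a)" by blast
qed (use assms W_upd in \<open>auto simp: hadj_def\<close>)

lemma simple_H: "simple_graph H"
  using finite_W by (auto simp: simple_graph_def H_def hadj_def card_2_iff)

lemma nbrs_H:
  assumes "x \<in> W"
  shows "nbrs H x = (\<lambda>(i, a). x(i := a)) ` (SIGMA i:{..<j}. {..<n i} - {x i})"
proof -
  have "nbrs H x = {y. \<exists>i<j. hadj i x y}"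
    by (auto simp: nbrs_def edge_H_iff hadj_def)
  also have "\<dots> = {y. \<exists>i<j. \<exists>a. a < n i \<and> a \<noteq> x i \<and> y = x(i := a)}"
    using hadj_iff_upd[OF assms] by blast
  finally show ?thesis by (auto simp: image_iff)
qed

lemma inj_on_upd: "inj_on (\<lambda>(i, a). x(i := a)) (SIGMA i:{..<j}. {..<n i} - {x i})"
  by (auto simp: inj_on_def) (metis fun_upd_apply)+

lemma card_nbrs_H:
  assumes "x \<in> W"
  shows "card (nbrs H x) = d"
  using W_less[OF assms]
  by (simp add: nbrs_H[OF assms] card_image[OF inj_on_upd] d_def)

text \<open>Each \<open>J i f x\<close> also counts \<open>x\<close> itself, at
  \<open>a = x i\<close>; this happens once per direction.\<close>

lemma sum_nbrs_H:
  assumes "x \<in> W"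
  shows "(\<Sum>y \<in> nbrs H x. f y) = (\<Sum>i<j. J i f x) - real j * f x"
proof -
  have "(\<Sum>y \<in> nbrs H x. f y) = (\<Sum>i<j. \<Sum>a \<in> {..<n i} - {x i}. f (x(i := a)))"
    unfolding nbrs_H[OF assms] sum.reindex[OF inj_on_upd]
    by (simp add: sum.Sigma o_def case_prod_unfold)
  also have "\<dots> = (\<Sum>i<j. J i f x - f x)"
    using W_less[OF assms] by (intro sum.cong) (auto simp: sum_diff1 J_def)
  finally show ?thesis by (simp add: sum_subtractf)
qed

lemma real_d: "real d = (\<Sum>i<j. real (n i)) - real j"
proof -
  have "real d = (\<Sum>i<j. real (n i) - 1)"
    using n_ge by (force simp: d_def of_nat_diff intro!: sum.cong)
  then show ?thesis by (simp add: sum_subtractf)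
qed

text \<open>The first bound makes degrees recognise branch vertices, the second places -d below the
  spectrum of \<open>H\<close>, and the third makes the order of the final graph grow with
  \<open>n 0\<close>.\<close>

lemma d_bounds: "3 \<le> d" "j < d" "n 0 \<le> d + 1"
proof -
  have "(\<Sum>i<j. 3) \<le> d"
    unfolding d_def using n_ge by (intro sum_mono) force
  then show "3 \<le> d" "j < d" using j by simp_all
  have "n 0 - 1 \<le> d"
    unfolding d_def using j by (intro member_le_sum) auto
  then show "n 0 \<le> d + 1" by simp
qed

section \<open>Spectrum of the Hamming graph\<close>

lemma J_upd [simp]: "J i f (x(i := a)) = J i f x"
  by (simp add: J_def)

lemma J_J: "J i (J i f) x = real (n i) * J i f x"
  by (subst J_def) simp

lemma J_commute: "J i (J l f) x = J l (J i f) x"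
proof (cases "i = l")
  case False
  then show ?thesis
    by (simp add: J_def fun_upd_twist[of i l]) (rule sum.swap)
qed simp

lemma sum_upd:
  assumes "i < j"
  shows "(\<Sum>x\<in>W. \<Sum>a<n i. g (x(i := a))) = real (n i) * (\<Sum>x\<in>W. g x)"
proof -
  have "(\<Sum>x\<in>W. \<Sum>a<n i. g (x(i := a))) = (\<Sum>(x, a) \<in> W \<times> {..<n i}. g (x(i := a)))"
    by (simp add: sum.cartesian_product)
  \<comment> \<open>Exchanging the coordinate \<open>x i\<close> with the extra index
    \<open>a\<close> is an involution of the index set.\<close>
  also have "\<dots> = (\<Sum>(x, a) \<in> W \<times> {..<n i}. g x)"
    by (rule sum.reindex_bij_witness[where i = "\<lambda>(x, a). (x(i := a), x i)" and j = "\<lambda>(x, a). (x(i := a), x i)"])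
      (use assms W_less W_upd in auto)
  also have "\<dots> = (\<Sum>x\<in>W. \<Sum>a<n i. g x)"
    by (rule sum.cartesian_product[symmetric])
  finally show ?thesis by (simp add: sum_distrib_left)
qed

text \<open>\<open>J i\<close> is \<open>n i\<close> times the orthogonal projection onto functions
  constant on lines in direction \<open>i\<close>; hence \<open>n i\<close> times the quadratic form
  is the squared norm of \<open>J i h\<close>.\<close>

lemma J_psd:
  assumes "i < j"
  shows "(\<Sum>x\<in>W. h x * J i h x) \<ge> 0"
proof -
  have "real (n i) * (\<Sum>x\<in>W. h x * J i h x) = (\<Sum>x\<in>W. \<Sum>a<n i. h (x(i := a)) * J i h x)"
    using sum_upd[OF assms, of "\<lambda>x. h x * J i h x"] by simp
  also have "\<dots> = (\<Sum>x\<in>W. J i h x * J i h x)"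
    by (simp add: J_def sum_distrib_right)
  finally have "real (n i) * (\<Sum>x\<in>W. h x * J i h x) \<ge> 0" by (simp add: sum_nonneg)
  then show ?thesis using n_ge[OF assms] by (simp add: zero_le_mult_iff)
qed

text \<open>Pairing the equation with \<open>h\<close> gives a nonnegative left side and
  \<open>c\<close> times a squared norm. The set \<open>I\<close> is left free because one
  application omits a direction.\<close>

lemma J_negative_eigenvalue:
  assumes I: "I \<subseteq> {..<j}" and c: "c < 0"
    and h: "\<And>x. x \<in> W \<Longrightarrow> (\<Sum>i\<in>I. J i h x) = c * h x"
    and x: "x \<in> W"
  shows "h x = 0"
proof -
  have "c * (\<Sum>x\<in>W. h x * h x) = (\<Sum>x\<in>W. h x * (\<Sum>i\<in>I. J i h x))"
    by (simp add: h sum_distrib_left algebra_simps cong: sum.cong)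
  also have "\<dots> = (\<Sum>i\<in>I. \<Sum>x\<in>W. h x * J i h x)"
    unfolding sum_distrib_left by (rule sum.swap)
  also have "\<dots> \<ge> 0" using I J_psd by (intro sum_nonneg[where A = I]) auto
  finally have "(\<Sum>x\<in>W. h x * h x) \<le> 0" using c by (simp add: zero_le_mult_iff)
  then have "(\<Sum>x\<in>W. h x * h x) = 0" by (intro antisym) (simp_all add: sum_nonneg)
  then show ?thesis using x finite_W by (simp add: sum_nonneg_eq_0_iff)
qed

text \<open>A null function has \<open>j\<close> as eigenvalue of the sum of all \<open>J i\<close>.
  Applying \<open>J l\<close>, and using that \<open>J l\<close> acts on its own image as the scalar
  \<open>n l\<close>, shows that \<open>J l f\<close> has eigenvalue \<open>j - n l < 0\<close> for
  the remaining sum, so it vanishes. With every \<open>J l f\<close> zero, only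
  \<open>j * f x = 0\<close> is left.\<close>

lemma H_nonsingular:
  fixes f :: "(nat \<Rightarrow> nat) \<Rightarrow> real"
  assumes f: "\<And>x. x \<in> W \<Longrightarrow> (\<Sum>y \<in> nbrs H x. f y) = 0" and x: "x \<in> W"
  shows "f x = 0"
proof -
  have Jf: "(\<Sum>i<j. J i f x) = real j * f x" if "x \<in> W" for x
    using f[OF that] sum_nbrs_H[OF that] by simp
  have "J l f x = 0" if l: "l < j" for l
  proof (rule J_negative_eigenvalue[where h = "J l f" and I = "{..<j} - {l}" and c = "real j - real (n l)"])
    show "real j - real (n l) < 0" using n_gt[OF l] by simp
    fix x assume x: "x \<in> W"
    have "(\<Sum>i<j. J i (J l f) x) = (\<Sum>i<j. J l (J i f) x)" by (simp only: J_commute)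
    also have "\<dots> = (\<Sum>a<n l. \<Sum>i<j. J i f (x(l := a)))" unfolding J_def[of l] by (rule sum.swap)
    also have "\<dots> = (\<Sum>a<n l. real j * f (x(l := a)))"
      using x l by (intro sum.cong Jf W_upd) auto
    also have "\<dots> = real j * J l f x" by (simp add: J_def sum_distrib_left)
    finally show "(\<Sum>i\<in>{..<j} - {l}. J i (J l f) x) = (real j - real (n l)) * J l f x"
      using l by (simp add: sum_diff1 J_J algebra_simps)
  qed (use x in auto)
  then have "real j * f x = 0" using Jf[OF x] by simp
  then show ?thesis using j by simp
qed

lemma H_min_eigenvalue:
  fixes f :: "(nat \<Rightarrow> nat) \<Rightarrow> real"
  assumes f: "\<And>x. x \<in> W \<Longrightarrow> (\<Sum>y \<in> nbrs H x. f y) = - real d * f x" and x: "x \<in> W"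
  shows "f x = 0"
proof (rule J_negative_eigenvalue[where h = f and I = "{..<j}" and c = "real j - real d"])
  show "real j - real d < 0" using d_bounds by simp
  show "(\<Sum>i<j. J i f x) = (real j - real d) * f x" if "x \<in> W" for x
    using f[OF that] sum_nbrs_H[OF that] by (simp add: algebra_simps)
qed (use x in auto)

text \<open>Maximum principle: the maximum of an eigenfunction for the degree spreads along lines.\<close>

lemma H_max_eigenvalue:
  fixes f :: "(nat \<Rightarrow> nat) \<Rightarrow> real"
  assumes f: "\<And>x. x \<in> W \<Longrightarrow> (\<Sum>y \<in> nbrs H x. f y) = real d * f x"
  shows "\<exists>c. \<forall>x \<in> W. f x = c"
proof -
  define M where "M = Max (f ` W)"
  have le: "f x \<le> M" if "x \<in> W" for x using that finite_W by (simp add: M_def)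
  obtain x0 where x0: "x0 \<in> W" "f x0 = M"
    using Max_in[of "f ` W"] finite_W W_nonempty unfolding M_def by fastforce
  have step: "f (x(i := a)) = M" if x: "x \<in> W" "f x = M" and i: "i < j" "a < n i" for x i a
  proof -
    have "(\<Sum>i<j. J i f x) = (\<Sum>i<j. real (n i)) * M"
      using f[OF x(1)] sum_nbrs_H[OF x(1)] x(2) by (simp add: real_d algebra_simps)
    then have "(\<Sum>i<j. \<Sum>a<n i. M - f (x(i := a))) = 0"
      by (simp add: J_def sum_subtractf sum_distrib_right)
    moreover have "\<forall>i\<in>{..<j}. (\<Sum>a<n i. M - f (x(i := a))) \<ge> 0"
      using le W_upd x by (auto intro!: sum_nonneg)
    ultimately have "(\<Sum>a<n i. M - f (x(i := a))) = 0"
      using i by (subst (asm) sum_nonneg_eq_0_iff) auto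
    then show ?thesis
      using i le W_upd x by (subst (asm) sum_nonneg_eq_0_iff) auto
  qed
  have "f y = M" if y: "y \<in> W" for y
  proof -
    \<comment> \<open>\<open>z m\<close> leads from \<open>x0\<close> to \<open>y\<close> one
      coordinate at a time, so each move stays on a line and \<open>step\<close> applies.\<close>
    define z where "z m l = (if l < m then y l else x0 l)" for m l
    have "z m \<in> W \<and> f (z m) = M" if "m \<le> j" for m
      using that
    proof (induction m)
      case 0
      then show ?case using x0 by (simp add: z_def)
    next
      case (Suc m)
      have z_Suc: "z (Suc m) = (z m)(m := y m)" by (auto simp: z_def less_Suc_eq)
      have "(z m)(m := y m) \<in> W" "f ((z m)(m := y m)) = M"
        using Suc step[of "z m" m "y m"] W_upd[of "z m" m "y m"] W_less[OF y, of m] by simp_all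
      then show ?case unfolding z_Suc by blast
    qed
    moreover have "z j = y"
      using x0 y by (auto simp: z_def W_def PiE_iff extensional_def)
    ultimately show ?thesis by force
  qed
  then show ?thesis by blast
qed

section \<open>Triangles and symmetries of the Hamming graph\<close>

lemma triangles_H:
  assumes "hadj i x y"
  shows "triangles H {x, y} = n i - 2"
proof -
  have x: "x \<in> W" "y \<in> W" "i < j" "x i \<noteq> y i" and eq: "\<And>l. l \<noteq> i \<Longrightarrow> x l = y l"
    using assms by (auto simp: hadj_def)
  \<comment> \<open>A neighbour of \<open>x\<close> in a direction \<open>l\<close> other than
    \<open>i\<close> differs from \<open>y\<close> in both \<open>i\<close> and \<open>l\<close>.
    Common neighbours therefore lie on the line through \<open>x\<close> and \<open>y\<close>, which
    has \<open>n i - 2\<close> further points.\<close>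
  have "(\<exists>l. hadj l x w) \<and> (\<exists>l. hadj l y w) \<longleftrightarrow> hadj i x w \<and> w i \<noteq> y i" for w
  proof safe
    fix l l' assume l: "hadj l x w" "hadj l' y w"
    have "l = i"
    proof (rule ccontr)
      assume "l \<noteq> i"
      then have "w i = x i" "w l \<noteq> y l" using l eq by (auto simp: hadj_def)
      then show False using l x by (metis hadj_def)
    qed
    then have "hadj i x w" using l by simp
    moreover have "l' = i"
    proof (rule ccontr)
      assume "l' \<noteq> i"
      then have "w l' = x l'" "w l' \<noteq> y l'" using l \<open>hadj i x w\<close> by (auto simp: hadj_def)
      then show False using eq \<open>l' \<noteq> i\<close> by simp
    qed
    ultimately show "hadj i x w" "w i = y i \<Longrightarrow> False" using l by (auto simp: hadj_def)
  next
    assume "hadj i x w" "w i \<noteq> y i"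
    then have "hadj i y w" using x eq by (auto simp: hadj_def)
    then show "\<exists>l. hadj l y w" by blast
  qed blast
  then have "{w \<in> vertices H. \<forall>v \<in> {x, y}. {v, w} \<in> edges H} = {w. hadj i x w \<and> w i \<noteq> y i}"
    by (auto simp: edge_H_iff hadj_def)
  also have "\<dots> = (\<lambda>a. x(i := a)) ` ({..<n i} - {x i, y i})"
    using hadj_iff_upd[OF x(1,3)] by auto
  finally have "triangles H {x, y} = card ((\<lambda>a. x(i := a)) ` ({..<n i} - {x i, y i}))"
    by (simp add: triangles_def)
  also have "\<dots> = card ({..<n i} - {x i, y i})"
    by (intro card_image inj_onI) (metis fun_upd_same)
  also have "\<dots> = n i - 2"
    using x W_less by (subst card_Diff_subset) auto
  finally show ?thesis .
qed

lemma coordinatewise_aut: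
  assumes p: "\<And>l. l < j \<Longrightarrow> bij_betw (p l) {..<n l} {..<n l}"
  shows "graph_iso H H (\<lambda>z. \<lambda>l\<in>{..<j}. p l (z l))"
proof (rule graph_isoI[OF simple_H])
  let ?\<pi> = "\<lambda>z. \<lambda>l\<in>{..<j}. p l (z l)"
  have in_W: "?\<pi> z \<in> W" if "z \<in> W" for z
    using that p by (auto simp: W_def dest!: bij_betwE)
  then show "?\<pi> ` vertices H \<subseteq> vertices H" by auto
  have inj: "p l (z l) = p l (w l) \<longleftrightarrow> z l = w l" if "z \<in> W" "w \<in> W" "l < j" for z w l
    using p[OF that(3)] W_less that by (metis bij_betw_def inj_on_eq_iff lessThan_iff)
  show "inj_on ?\<pi> (vertices H)"
  proof (rule inj_onI)
    fix z w assume z: "z \<in> vertices H" "w \<in> vertices H" and eq: "?\<pi> z = ?\<pi> w"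
    have "z l = w l" for l
    proof (cases "l < j")
      case True
      then show ?thesis using fun_cong[OF eq, of l] inj z by simp
    next
      case False
      then show ?thesis using z by (simp add: W_def PiE_iff extensional_def)
    qed
    then show "z = w" by blast
  qed
  fix u v assume "{u, v} \<in> edges H"
  then obtain i where "hadj i u v" by (auto simp: edge_H_iff)
  then have "hadj i (?\<pi> u) (?\<pi> v)"
    using in_W inj by (auto simp: hadj_def)
  then show "{?\<pi> u, ?\<pi> v} \<in> edges H" by (auto simp: edge_H_iff)
qed

lemma hadj_transitive:
  assumes "hadj i x y" "hadj i x' y'"
  shows "\<exists>\<pi>. graph_iso H H \<pi> \<and> \<pi> x = x' \<and> \<pi> y = y'"
proof -
  define \<tau> where "\<tau> l = transpose (x l) (x' l)" for l
  \<comment> \<open>The first transposition takes \<open>x l\<close> to \<open>x' l\<close>; the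
    second corrects the image of \<open>y l\<close>. It leaves \<open>x' l\<close> in place: for
    \<open>l = i\<close> both points it exchanges differ from \<open>x' l\<close>, and otherwise it
    is the identity.\<close>
  define p where "p l = transpose (\<tau> l (y l)) (y' l) \<circ> \<tau> l" for l
  have W: "x \<in> W" "x' \<in> W" "y \<in> W" "y' \<in> W" using assms by (auto simp: hadj_def)
  have bt: "bij_betw (\<tau> l) {..<n l} {..<n l}" if "l < j" for l
    unfolding \<tau>_def using W W_less that by (intro bij_betw_transpose_less) auto
  have "bij_betw (p l) {..<n l} {..<n l}" if "l < j" for l
    unfolding p_def using that bt[OF that] W W_less[OF _ that]
    by (intro bij_betw_trans[OF bt[OF that]] bij_betw_transpose_less) (auto dest: bij_betwE)
  then have iso: "graph_iso H H (\<lambda>z. \<lambda>l\<in>{..<j}. p l (z l))" by (rule coordinatewise_aut)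
  have px: "p l (x l) = x' l" for l
  proof (cases "l = i")
    case True
    then have "x l \<noteq> y l" "x' l \<noteq> y' l" using assms by (auto simp: hadj_def)
    then show ?thesis by (auto simp: p_def \<tau>_def transpose_def)
  next
    case False
    then have "x l = y l" "x' l = y' l" using assms by (auto simp: hadj_def)
    then show ?thesis by (auto simp: p_def \<tau>_def transpose_def)
  qed
  have "p l (y l) = y' l" for l by (simp add: p_def)
  then have "(\<lambda>l\<in>{..<j}. p l (x l)) = x'" "(\<lambda>l\<in>{..<j}. p l (y l)) = y'"
    using W px by (auto simp: W_def PiE_iff extensional_def)
  with iso show ?thesis by blast
qed

lemma hadj_exists:
  assumes "x \<in> W" "i < j"
  shows "\<exists>y. hadj i x y"
proof -
  have "(if x i = 0 then 1 else 0) < n i" using n_ge[OF assms(2)] by auto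
  then show ?thesis using hadj_iff_upd[OF assms] by force
qed

lemma triangles_image_H: "triangles H ` edges H = (\<lambda>i. n i - 2) ` {..<j}"
proof safe
  fix e assume "e \<in> edges H"
  then obtain x y i where "e = {x, y}" "hadj i x y" by (auto simp: H_def)
  then show "triangles H e \<in> (\<lambda>i. n i - 2) ` {..<j}"
    using triangles_H by (auto simp: hadj_def)
next
  fix i assume i: "i < j"
  obtain x where "x \<in> W" using W_nonempty by blast
  then obtain y where y: "hadj i x y" using hadj_exists i by blast
  then have "{x, y} \<in> edges H" by (auto simp: edge_H_iff)
  then show "n i - 2 \<in> triangles H ` edges H" using triangles_H[OF y] by (metis imageI)
qed

text \<open>By \<open>n_ge\<close> the truncated subtraction loses nothing.\<close>

lemma n_minus_inj: "inj_on (\<lambda>i. n i - 2) {..<j}"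
proof (rule inj_onI)
  fix i l assume "i \<in> {..<j}" "l \<in> {..<j}" "n i - 2 = n l - 2"
  then show "i = l" using n_ge[of i] n_ge[of l] inj_onD[OF n_inj, of i l] by simp
qed

lemma arc_transitive_H:
  assumes "{x, y} \<in> edges H" "{x', y'} \<in> edges H" "triangles H {x, y} = triangles H {x', y'}"
  shows "\<exists>\<pi>. graph_iso H H \<pi> \<and> \<pi> x = x' \<and> \<pi> y = y'"
proof -
  obtain i i' where h: "hadj i x y" "hadj i' x' y'" using assms by (auto simp: edge_H_iff)
  then have "n i - 2 = n i' - 2" "i < j" "i' < j"
    using assms(3) triangles_H by (auto simp: hadj_def)
  then have "i = i'" using inj_onD[OF n_minus_inj, of i i'] by simp
  then show ?thesis using h hadj_transitive by blast
qed

lemma vertex_transitive_H: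
  assumes "x \<in> W" "x' \<in> W"
  shows "\<exists>\<pi>. graph_iso H H \<pi> \<and> \<pi> x = x'"
proof -
  obtain y y' where "hadj 0 x y" "hadj 0 x' y'" using hadj_exists assms j by force
  then show ?thesis using hadj_transitive by blast
qed

end

section \<open>Threading a graph through a complete bipartite graph\<close>

text \<open>\<open>Core x s a\<close> is vertex \<open>a\<close> on side \<open>s\<close> of the
  copy of K_{d,d} over \<open>x\<close>. \<open>Mid x a b t\<close> is the inner vertex at position
  \<open>t\<close> on the path from \<open>Core x False a\<close> to
  \<open>Core x True b\<close>.\<close>

datatype 'w vert = Core 'w bool nat | Mid 'w nat nat nat

text \<open>Collects what the kernel and orbit arguments use about \<open>H\<close>, so that Hamming
  coordinates no longer appear in them.\<close>

locale threading =
  fixes H :: "'w ugraph" and d m :: nat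
  assumes simple_H: "simple_graph H"
    and nonempty: "vertices H \<noteq> {}"
    and degree: "\<And>x. x \<in> vertices H \<Longrightarrow> card (nbrs H x) = d"
    and d_ge: "d \<ge> 3"
    and nonsingular: "\<And>f x. (\<And>x. x \<in> vertices H \<Longrightarrow> (\<Sum>y \<in> nbrs H x. f y) = (0 :: real)) \<Longrightarrow>
      x \<in> vertices H \<Longrightarrow> f x = 0"
    and min_eigenvalue: "\<And>f x. (\<And>x. x \<in> vertices H \<Longrightarrow> (\<Sum>y \<in> nbrs H x. f y) = - real d * f x) \<Longrightarrow>
      x \<in> vertices H \<Longrightarrow> f x = 0"
    and max_eigenvalue: "\<And>f. (\<And>x. x \<in> vertices H \<Longrightarrow> (\<Sum>y \<in> nbrs H x. f y) = real d * f x) \<Longrightarrow>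
      \<exists>c. \<forall>x \<in> vertices H. f x = c"
    and vertex_transitive: "\<And>x x'. x \<in> vertices H \<Longrightarrow> x' \<in> vertices H \<Longrightarrow>
      \<exists>\<pi>. graph_iso H H \<pi> \<and> \<pi> x = x'"
    and arc_transitive: "\<And>x y x' y'. {x, y} \<in> edges H \<Longrightarrow> {x', y'} \<in> edges H \<Longrightarrow>
      triangles H {x, y} = triangles H {x', y'} \<Longrightarrow>
      \<exists>\<pi>. graph_iso H H \<pi> \<and> \<pi> x = x' \<and> \<pi> y = y'"
    and triangles_pos: "\<And>e. e \<in> edges H \<Longrightarrow> triangles H e > 0"
begin

text \<open>The graph below is the Cartesian product of \<open>H\<close> with \<open>K\<^bsub>d,d\<^esub>\<close> (the Boolean picks the
  side) in which every edge of a copy of \<open>K\<^bsub>d,d\<^esub>\<close> is subdivided by \<open>2 * m\<close> vertices;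
  \<open>node x a b\<close> runs along such a path from one end to the other.\<close>

definition node :: "'w \<Rightarrow> nat \<Rightarrow> nat \<Rightarrow> nat \<Rightarrow> 'w vert" where
  "node x a b t = (if t = 0 then Core x False a else if t = Suc (2 * m) then Core x True b else Mid x a b t)"

text \<open>The disjunct with \<open>m = 0\<close> provides the edges of K_{d,d} when there is
  nothing to subdivide. Index bounds are left to \<open>is_vert\<close>.\<close>

fun adj :: "'w vert \<Rightarrow> 'w vert \<Rightarrow> bool" where
  "adj (Core x s a) (Core y s' a') \<longleftrightarrow>
     {x, y} \<in> edges H \<and> s = s' \<and> a = a' \<or> m = 0 \<and> x = y \<and> s \<noteq> s'"
| "adj (Core x s a) (Mid y b c t) \<longleftrightarrow>
     x = y \<and> (if s then a = c \<and> t = 2 * m else a = b \<and> t = 1)"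
| "adj (Mid y b c t) (Core x s a) \<longleftrightarrow>
     x = y \<and> (if s then a = c \<and> t = 2 * m else a = b \<and> t = 1)"
| "adj (Mid x a b t) (Mid y a' b' u) \<longleftrightarrow>
     x = y \<and> a = a' \<and> b = b' \<and> (u = Suc t \<or> t = Suc u)"

fun is_vert :: "'w vert \<Rightarrow> bool" where
  "is_vert (Core x s a) \<longleftrightarrow> x \<in> vertices H \<and> a < d"
| "is_vert (Mid x a b t) \<longleftrightarrow> x \<in> vertices H \<and> a < d \<and> b < d \<and> 1 \<le> t \<and> t \<le> 2 * m"

definition G :: "'w vert ugraph" where
  "G = \<lparr>vertices = Collect is_vert, edges = {{u, v} | u v. is_vert u \<and> is_vert v \<and> adj u v}\<rparr>"

lemma in_vertices_G [simp]: "v \<in> vertices G \<longleftrightarrow> is_vert v"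
  by (simp add: G_def)

lemma edge_H_distinct: "{x, y} \<in> edges H \<Longrightarrow> x \<noteq> y"
  using simple_H by (auto simp: simple_graph_def)

lemma edge_H_vertices: "{x, y} \<in> edges H \<Longrightarrow> x \<in> vertices H \<and> y \<in> vertices H"
  using simple_H by (auto simp: simple_graph_def)

lemma finite_H: "finite (vertices H)"
  using simple_H by (simp add: simple_graph_def)

lemma finite_nbrs_H: "finite (nbrs H x)"
  using finite_H by (simp add: nbrs_def)

lemma adj_sym: "adj u v \<longleftrightarrow> adj v u"
  by (cases u; cases v) (auto simp: insert_commute)

lemma adj_irrefl: "\<not> adj u u"
proof (cases u)
  case (Core x s a)
  then show ?thesis using edge_H_distinct[of x x] by auto
qed simp

lemma edge_G_iff [simp]: "{u, v} \<in> edges G \<longleftrightarrow> is_vert u \<and> is_vert v \<and> adj u v"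
  using adj_sym by (auto simp: G_def doubleton_eq_iff)

lemma finite_G: "finite (vertices G)"
proof (rule finite_subset)
  show "vertices G \<subseteq> (\<lambda>(x, s, a). Core x s a) ` (vertices H \<times> UNIV \<times> {..<d}) \<union>
    (\<lambda>(x, a, b, t). Mid x a b t) ` (vertices H \<times> {..<d} \<times> {..<d} \<times> {..2 * m})"
  proof
    fix v assume "v \<in> vertices G"
    then show "v \<in> (\<lambda>(x, s, a). Core x s a) ` (vertices H \<times> UNIV \<times> {..<d}) \<union>
      (\<lambda>(x, a, b, t). Mid x a b t) ` (vertices H \<times> {..<d} \<times> {..<d} \<times> {..2 * m})"
      by (cases v) (force simp: image_iff)+
  qed
qed (use finite_H in auto)

lemma simple_G: "simple_graph G"
  unfolding simple_graph_def
proof (intro conjI ballI)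
  fix e assume "e \<in> edges G"
  then obtain u v where "e = {u, v}" "is_vert u" "is_vert v" "adj u v" by (auto simp: G_def)
  moreover from this have "u \<noteq> v" using adj_irrefl by blast
  ultimately show "e \<subseteq> vertices G" "card e = 2" by auto
qed (rule finite_G)

lemma is_vert_node:
  "x \<in> vertices H \<Longrightarrow> a < d \<Longrightarrow> b < d \<Longrightarrow> t \<le> Suc (2 * m) \<Longrightarrow> is_vert (node x a b t)"
  by (auto simp: node_def)

lemma adj_node:
  assumes "t \<le> 2 * m"
  shows "adj (node x a b t) (node x a b (Suc t))"
proof (cases "t = 0 \<and> m = 0")
  case True
  then have nodes: "node x a b t = Core x False a" "node x a b (Suc t) = Core x True b"
    unfolding node_def by simp_all
  show ?thesis unfolding nodes adj.simps using True by simp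
next
  case False
  then show ?thesis using assms by (auto simp: node_def)
qed

lemma node_inj: "t \<le> Suc (2 * m) \<Longrightarrow> t' \<le> Suc (2 * m) \<Longrightarrow> node x a b t = node x a b t' \<longleftrightarrow> t = t'"
  by (auto simp: node_def)

text \<open>\<open>node\<close> yields branch vertices at both ends, so the first and last inner
  vertices fit the same formula.\<close>

lemma nbrs_Mid:
  assumes "is_vert (Mid x a b t)"
  shows "nbrs G (Mid x a b t) = {node x a b (t - 1), node x a b (Suc t)}"
proof -
  have "is_vert v \<and> adj (Mid x a b t) v \<longleftrightarrow> v = node x a b (t - 1) \<or> v = node x a b (Suc t)" for v
    using assms by (cases v) (auto simp: node_def split: if_splits)
  then show ?thesis using assms by (auto simp: nbrs_def)
qed

text \<open>The neighbour of \<open>Core x s a\<close> on the path towards \<open>Core x (\<not> s) b\<close>.\<close>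

definition port :: "'w \<Rightarrow> bool \<Rightarrow> nat \<Rightarrow> nat \<Rightarrow> 'w vert" where
  "port x s a b = (if s then node x b a (2 * m) else node x a b 1)"

text \<open>For \<open>m = 0\<close> a port is already the opposite branch vertex, so one formula
  serves every \<open>m\<close>.\<close>

lemma nbrs_Core:
  assumes "is_vert (Core x s a)"
  shows "nbrs G (Core x s a) = (\<lambda>y. Core y s a) ` nbrs H x \<union> port x s a ` {..<d}"
proof -
  have "is_vert v \<and> adj (Core x s a) v \<longleftrightarrow> v \<in> (\<lambda>y. Core y s a) ` nbrs H x \<union> port x s a ` {..<d}" for v
    using assms
    by (cases v) (auto simp: node_def port_def nbrs_def image_iff split: if_splits)
  then show ?thesis using assms by (auto simp: nbrs_def)
qed

lemma sum_nbrs_Mid: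
  assumes "is_vert (Mid x a b t)"
  shows "(\<Sum>v \<in> nbrs G (Mid x a b t). f v) = f (node x a b (t - 1)) + f (node x a b (Suc t))"
proof -
  have "node x a b (t - 1) \<noteq> node x a b (Suc t)"
    using assms by (subst node_inj) auto
  then show ?thesis by (simp add: nbrs_Mid[OF assms])
qed

lemma sum_nbrs_Core:
  assumes "is_vert (Core x s a)"
  shows "(\<Sum>v \<in> nbrs G (Core x s a). f v) =
    (\<Sum>y \<in> nbrs H x. f (Core y s a)) + (\<Sum>b<d. f (port x s a b))"
proof -
  have "Core y s a \<noteq> port x s a b" if "y \<in> nbrs H x" for b y
    using that edge_H_distinct by (auto simp: port_def node_def nbrs_def)
  then have "(\<lambda>y. Core y s a) ` nbrs H x \<inter> port x s a ` {..<d} = {}" by auto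
  moreover have "inj_on (\<lambda>y. Core y s a) (nbrs H x)" by (auto simp: inj_on_def)
  moreover have "inj_on (port x s a) {..<d}" by (auto simp: inj_on_def port_def node_def split: if_splits)
  ultimately show ?thesis
    by (simp add: nbrs_Core[OF assms] sum.union_disjoint finite_nbrs_H sum.reindex)
qed

section \<open>Null vectors of the threaded graph\<close>

text \<open>Along a path the entries are 1, -1, -1, 1, 1, -1, ...: two steps change the sign, and
  the first port is opposite to its branch vertex. At position \<open>2 * m + 1\<close> this gives
  \<open>(-1) ^ Suc m\<close>, the entry on side \<open>True\<close>.\<close>

fun weight :: "'w vert \<Rightarrow> real" where
  "weight (Core x s a) = (if s then (-1) ^ Suc m else 1)"
| "weight (Mid x a b t) = (-1) ^ (Suc t div 2)"

lemma weight_node: "t \<le> Suc (2 * m) \<Longrightarrow> weight (node x a b t) = (-1) ^ (Suc t div 2)"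
  by (auto simp: node_def)

lemma weight_nonzero: "weight v \<noteq> 0"
  by (cases v) auto

lemma null_weight: "null_fun G weight"
  unfolding null_fun_def
proof
  fix v assume "v \<in> vertices G"
  then have v: "is_vert v" by simp
  show "(\<Sum>u \<in> nbrs G v. weight u) = 0"
  proof (cases v)
    case (Core x s a)
    \<comment> \<open>Each of the \<open>d\<close> ports carries the negative of the entry at
      \<open>Core x s a\<close> and cancels one of the \<open>d\<close> neighbours inside the copy
      of \<open>H\<close>.\<close>
    have "(\<Sum>b<d. weight (port x s a b)) = (\<Sum>b<d. if s then (-1) ^ m else - 1)"
      by (intro sum.cong) (auto simp: port_def weight_node)
    then show ?thesis
      using v Core degree by (simp add: sum_nbrs_Core)
  next
    case (Mid x a b t)
    then obtain t' where t: "t = Suc t'" using v by (cases t) auto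
    then show ?thesis
      using v Mid by (simp add: sum_nbrs_Mid weight_node)
  qed
qed

text \<open>At an inner vertex the null condition says that its two neighbours have opposite values,
  so even positions depend on position 0 and odd ones on position 1.\<close>

lemma null_fun_node:
  assumes f: "null_fun G f" and x: "x \<in> vertices H" "a < d" "b < d"
  shows "i \<le> m \<Longrightarrow> f (node x a b (2 * i)) = (-1) ^ i * f (node x a b 0)"
    and "i \<le> m \<Longrightarrow> f (node x a b (Suc (2 * i))) = (-1) ^ i * f (node x a b 1)"
proof -
  have step: "f (node x a b (Suc (Suc t))) = - f (node x a b t)" if "t < 2 * m" for t
  proof -
    have v: "is_vert (Mid x a b (Suc t))" using that x by simp
    have "f (node x a b t) + f (node x a b (Suc (Suc t))) = 0"
      using f sum_nbrs_Mid[OF v, of f] v unfolding null_fun_def by fastforce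
    then show ?thesis by simp
  qed
  show "i \<le> m \<Longrightarrow> f (node x a b (2 * i)) = (-1) ^ i * f (node x a b 0)"
    by (induction i) (auto simp: step)
  show "i \<le> m \<Longrightarrow> f (node x a b (Suc (2 * i))) = (-1) ^ i * f (node x a b 1)"
    by (induction i) (auto simp: step)
qed

text \<open>A path with \<^term>\<open>2 * m\<close> inner vertices acts on null vectors like an edge of weight
  \<^term>\<open>(-1) ^ m\<close>.\<close>

lemma null_fun_port:
  assumes f: "null_fun G f" and x: "x \<in> vertices H" "a < d" "b < d"
  shows "f (port x s a b) = (-1) ^ m * f (Core x (\<not> s) b)"
proof (cases s)
  case True
  then show ?thesis
    using null_fun_node(1)[OF f, of x b a m] x by (simp add: port_def node_def)
next
  case False
  have "f (Core x True b) = (-1) ^ m * f (node x a b 1)"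
    using null_fun_node(2)[OF f, of x a b m] x by (simp add: node_def[of _ _ _ "Suc (2 * m)"])
  \<comment> \<open>Odd positions run from the port to the far end; as the sign squares to 1, the
    relation can be solved for the port.\<close>
  then have "(-1) ^ m * f (Core x True b) = ((-1) ^ m * (-1) ^ m) * f (node x a b 1)"
    by simp
  then show ?thesis
    using False by (simp add: port_def flip: power_mult_distrib)
qed

lemma null_fun_Core:
  assumes f: "null_fun G f"
  obtains c where "\<And>x s a. x \<in> vertices H \<Longrightarrow> a < d \<Longrightarrow> f (Core x s a) = c * weight (Core x s a)"
proof -
  \<comment> \<open>The sign carried by a path; the e of the overview is
    \<open>- \<epsilon>\<close>.\<close>
  define \<epsilon> :: real where "\<epsilon> = (-1) ^ m"
  have \<epsilon>2: "\<epsilon> * \<epsilon> = 1" by (simp add: \<epsilon>_def flip: power_mult_distrib)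
  have eq: "(\<Sum>y \<in> nbrs H x. f (Core y s a)) + \<epsilon> * (\<Sum>b<d. f (Core x (\<not> s) b)) = 0"
    if "x \<in> vertices H" "a < d" for x s a
  proof -
    have v: "is_vert (Core x s a)" using that by simp
    have "(\<Sum>y \<in> nbrs H x. f (Core y s a)) + (\<Sum>b<d. f (port x s a b)) = 0"
      using f sum_nbrs_Core[OF v, of f] v unfolding null_fun_def by fastforce
    also have "(\<Sum>b<d. f (port x s a b)) = (\<Sum>b<d. \<epsilon> * f (Core x (\<not> s) b))"
      using null_fun_port[OF f] that by (intro sum.cong) (auto simp: \<epsilon>_def)
    finally show ?thesis by (simp add: sum_distrib_left)
  qed
  define g where "g s x = f (Core x s 0)" for s x
  \<comment> \<open>In \<open>eq\<close> the sum over the opposite side does not involve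
    \<open>a\<close>, so the difference of two copies on one side is a null function of
    \<open>H\<close>.\<close>
  have g: "f (Core x s a) = g s x" if "x \<in> vertices H" "a < d" for x s a
  proof -
    have "f (Core x s a) - g s x = 0"
    proof (rule nonsingular[where f = "\<lambda>x. f (Core x s a) - g s x"])
      fix x assume "x \<in> vertices H"
      then show "(\<Sum>y \<in> nbrs H x. f (Core y s a) - g s y) = 0"
        using eq[of x a s] eq[of x 0 s] d_ge that by (simp add: sum_subtractf g_def)
    qed (rule that)
    then show ?thesis by simp
  qed
  have eig: "(\<Sum>y \<in> nbrs H x. g s y) = - \<epsilon> * real d * g (\<not> s) x" if x: "x \<in> vertices H" for x s
  proof -
    have "(\<Sum>b<d. f (Core x (\<not> s) b)) = real d * g (\<not> s) x"
      using g[OF x] by simp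
    then show ?thesis using eq[OF x, of 0 s] d_ge by (simp add: g_def)
  qed
  have opp: "g True x = - \<epsilon> * g False x" if x: "x \<in> vertices H" for x
  proof -
    have "g False x + \<epsilon> * g True x = 0"
    proof (rule min_eigenvalue[where f = "\<lambda>x. g False x + \<epsilon> * g True x"])
      fix x assume x: "x \<in> vertices H"
      have "(\<Sum>y \<in> nbrs H x. g False y + \<epsilon> * g True y) =
          - \<epsilon> * real d * g True x - (\<epsilon> * \<epsilon>) * real d * g False x"
        using eig[OF x, of False] eig[OF x, of True]
        by (simp add: sum.distrib flip: sum_distrib_left)
      then show "(\<Sum>y \<in> nbrs H x. g False y + \<epsilon> * g True y) = - real d * (g False x + \<epsilon> * g True x)"
        by (simp add: \<epsilon>2 algebra_simps)
    qed (rule x)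
    then have "\<epsilon> * g False x + (\<epsilon> * \<epsilon>) * g True x = 0"
      by (metis distrib_left mult.assoc mult_zero_right)
    then show ?thesis by (simp add: \<epsilon>2)
  qed
  have "\<exists>c. \<forall>x \<in> vertices H. g False x = c"
  proof (rule max_eigenvalue)
    fix x assume x: "x \<in> vertices H"
    have "(\<Sum>y \<in> nbrs H x. g False y) = (\<epsilon> * \<epsilon>) * real d * g False x"
      using eig[OF x, of False] opp[OF x] by simp
    then show "(\<Sum>y \<in> nbrs H x. g False y) = real d * g False x" by (simp add: \<epsilon>2)
  qed
  then obtain c where c: "\<And>x. x \<in> vertices H \<Longrightarrow> g False x = c" by blast
  have "f (Core x s a) = c * weight (Core x s a)" if "x \<in> vertices H" "a < d" for x s a
    using g[OF that, of s] opp[OF that(1)] c[OF that(1)] by (cases s) (auto simp: \<epsilon>_def)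
  then show ?thesis using that by blast
qed

lemma nut_weight: "nut_fun G weight"
  unfolding nut_fun_def
proof (intro conjI allI impI)
  fix f assume f: "null_fun G f"
  obtain c where core: "\<And>x s a. x \<in> vertices H \<Longrightarrow> a < d \<Longrightarrow> f (Core x s a) = c * weight (Core x s a)"
    using null_fun_Core[OF f] by blast
  have "f v = c * weight v" if v: "is_vert v" for v
  proof (cases v)
    case Core
    then show ?thesis using v core by simp
  next
    case (Mid x a b t)
    with v have x: "x \<in> vertices H" "a < d" "b < d" and t: "1 \<le> t" "t \<le> 2 * m" by auto
    have node0: "f (node x a b 0) = c" using core x by (simp add: node_def)
    have "f (node x a b 1) = (-1) ^ m * f (Core x True b)"
      using null_fun_port[OF f x, of False] by (simp add: port_def)
    also have "\<dots> = - c * ((-1) ^ m * (-1) ^ m)" using core[of x b True] x by simp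
    also have "\<dots> = - c" by (simp flip: power_mult_distrib)
    finally have node1: "f (node x a b 1) = - c" .
    have "f (node x a b t) = c * (-1) ^ (Suc t div 2)"
    proof (cases "even t")
      case True
      then obtain i where "t = 2 * i" by blast
      then show ?thesis using null_fun_node(1)[OF f x, of i] node0 t by simp
    next
      case False
      then obtain i where "t = Suc (2 * i)" by (metis oddE Suc_eq_plus1)
      then show ?thesis using null_fun_node(2)[OF f x, of i] node1 t by simp
    qed
    then show ?thesis using Mid t by (simp add: node_def)
  qed
  then show "\<exists>c. \<forall>v \<in> vertices G. f v = c * weight v" by auto
qed (auto simp: null_weight weight_nonzero)

end

section \<open>Orbits of the threaded graph\<close>

context threading
begin

text \<open>\<open>\<pi>\<close> moves the copies of K_{d,d}, \<open>\<sigma> s\<close> permutes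
  side \<open>s\<close>, and \<open>z\<close> swaps the sides. A swap reverses paths, hence the
  position \<open>Suc (2 * m) - t\<close> and the exchanged end indices.\<close>

fun lift_aut :: "('w \<Rightarrow> 'w) \<Rightarrow> (bool \<Rightarrow> nat \<Rightarrow> nat) \<Rightarrow> bool \<Rightarrow> 'w vert \<Rightarrow> 'w vert" where
  "lift_aut \<pi> \<sigma> z (Core x s a) = Core (\<pi> x) (s \<noteq> z) (\<sigma> s a)"
| "lift_aut \<pi> \<sigma> z (Mid x a b t) =
     (if z then Mid (\<pi> x) (\<sigma> True b) (\<sigma> False a) (Suc (2 * m) - t)
      else Mid (\<pi> x) (\<sigma> False a) (\<sigma> True b) t)"

lemma lift_aut_node:
  assumes "t \<le> Suc (2 * m)"
  shows "lift_aut \<pi> \<sigma> z (node x a b t) =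
    (if z then node (\<pi> x) (\<sigma> True b) (\<sigma> False a) (Suc (2 * m) - t)
     else node (\<pi> x) (\<sigma> False a) (\<sigma> True b) t)"
  using assms by (auto simp: node_def)

lemma graph_iso_lift_aut:
  assumes \<pi>: "graph_iso H H \<pi>" and \<sigma>: "\<And>s. bij_betw (\<sigma> s) {..<d} {..<d}"
  shows "graph_iso G G (lift_aut \<pi> \<sigma> z)"
proof (rule graph_isoI[OF simple_G])
  have \<pi>V: "\<pi> x \<in> vertices H" if "x \<in> vertices H" for x
    using graph_iso_vertex[OF \<pi> that] .
  have \<sigma>d: "\<sigma> s a < d" if "a < d" for s a
    using bij_betwE[OF \<sigma>[of s]] that by auto
  have \<pi>_inj: "\<pi> x = \<pi> y \<longleftrightarrow> x = y" if "x \<in> vertices H" "y \<in> vertices H" for x y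
    using \<pi> that by (auto simp: graph_iso_def bij_betw_def inj_on_eq_iff)
  have \<sigma>_inj: "\<sigma> s a = \<sigma> s b \<longleftrightarrow> a = b" if "a < d" "b < d" for s a b
    using \<sigma>[of s] that by (auto simp: bij_betw_def inj_on_eq_iff)
  have \<pi>E: "{\<pi> x, \<pi> y} \<in> edges H" if "{x, y} \<in> edges H" for x y
    using \<pi> that edge_H_vertices[OF that] by (simp add: graph_iso_def)
  have vert: "is_vert (lift_aut \<pi> \<sigma> z v)" if "is_vert v" for v
    using that by (cases v) (auto simp: \<pi>V \<sigma>d)
  then show "lift_aut \<pi> \<sigma> z ` vertices G \<subseteq> vertices G" by auto
  show "inj_on (lift_aut \<pi> \<sigma> z) (vertices G)"
  proof (rule inj_onI)
    fix u v assume "u \<in> vertices G" "v \<in> vertices G" "lift_aut \<pi> \<sigma> z u = lift_aut \<pi> \<sigma> z v"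
    then show "u = v"
      by (cases u; cases v; cases z) (auto simp: \<pi>_inj \<sigma>_inj)
  qed
  fix u v assume "{u, v} \<in> edges G"
  then have uv: "is_vert u" "is_vert v" "adj u v" by auto
  then have "adj (lift_aut \<pi> \<sigma> z u) (lift_aut \<pi> \<sigma> z v)"
    by (cases u; cases v; cases z) (auto simp: \<pi>E split: if_splits)
  then show "{lift_aut \<pi> \<sigma> z u, lift_aut \<pi> \<sigma> z v} \<in> edges G"
    using uv vert by simp
qed

section \<open>Depth and vertex orbits\<close>

fun depth :: "'w vert \<Rightarrow> nat" where
  "depth (Core x s a) = 0"
| "depth (Mid x a b t) = min t (Suc (2 * m) - t)"

lemma depth_node: "t \<le> Suc (2 * m) \<Longrightarrow> depth (node x a b t) = min t (Suc (2 * m) - t)"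
  by (auto simp: node_def)

text \<open>Branch vertices have at least \<open>d\<close> neighbours and inner vertices at most
  two, so the degree recognises depth 0.\<close>

lemma depth_0_iff:
  assumes "is_vert v"
  shows "depth v = 0 \<longleftrightarrow> card (nbrs G v) \<ge> 3"
proof (cases v)
  case (Core x s a)
  have "d = card ((\<lambda>y. Core y s a) ` nbrs H x)"
    using assms Core degree by (simp add: card_image inj_on_def)
  also have "\<dots> \<le> card (nbrs G v)"
    using assms Core finite_nbrs_H by (intro card_mono) (auto simp: nbrs_Core)
  finally show ?thesis using d_ge Core by simp
next
  case (Mid x a b t)
  then have "card (nbrs G v) \<le> 2"
    using assms nbrs_Mid[of x a b t] by (simp add: card_insert_if)
  moreover have "depth v \<noteq> 0" using Mid assms by auto
  ultimately show ?thesis by simp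
qed

text \<open>With \<open>depth_0_iff\<close>, this determines the depth from adjacency alone, so automorphisms preserve it.\<close>

lemma depth_Suc_iff:
  assumes "is_vert v"
  shows "depth v = Suc c \<longleftrightarrow> \<not> depth v \<le> c \<and> (\<exists>u \<in> nbrs G v. depth u = c)"
proof (cases v)
  case (Mid x a b t)
  with assms have t: "1 \<le> t" "t \<le> 2 * m" by auto
  have "(\<exists>u \<in> nbrs G v. depth u = c) \<longleftrightarrow>
      min (t - 1) (Suc (2 * m) - (t - 1)) = c \<or> min (Suc t) (Suc (2 * m) - Suc t) = c"
    using t assms Mid nbrs_Mid[of x a b t] by (simp add: depth_node)
  then show ?thesis using t Mid by (auto simp: min_def)
qed simp

lemma depth_invariant:
  assumes g: "graph_iso G G g" and v: "is_vert v"
  shows "depth (g v) = depth v"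
proof -
  have gv: "is_vert (g v)" if "is_vert v" for v using graph_iso_vertex[OF g, of v] that by simp
  have nbrs: "nbrs G (g v) = g ` nbrs G v" if "is_vert v" for v
    using graph_iso_image_nbrs[OF g] that by simp
  \<comment> \<open>One value \<open>c\<close> is tested at a time. Strong induction is used because
    the test for \<open>Suc c'\<close> involves \<open>depth v \<le> c'\<close>, that is, all
    smaller values.\<close>
  have "depth (g v) = c \<longleftrightarrow> depth v = c" if "is_vert v" for c v
    using that
  proof (induction c arbitrary: v rule: less_induct)
    case (less c)
    show ?case
    proof (cases c)
      case 0
      have "inj_on g (nbrs G v)"
        using g by (auto simp: nbrs_def graph_iso_def bij_betw_def intro: inj_on_subset)
      then have "card (nbrs G (g v)) = card (nbrs G v)"
        using nbrs[OF less.prems] by (simp add: card_image)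
      then show ?thesis
        using 0 depth_0_iff[OF less.prems] depth_0_iff[OF gv[OF less.prems]] by simp
    next
      case (Suc c')
      have "depth (g v) \<le> c' \<longleftrightarrow> depth v \<le> c'"
        using less.IH[OF _ less.prems] Suc by (metis le_imp_less_Suc)
      moreover have "(\<exists>u \<in> nbrs G (g v). depth u = c') \<longleftrightarrow> (\<exists>u \<in> nbrs G v. depth u = c')"
        using less.IH[of c'] Suc nbrs[OF less.prems] by (auto simp: nbrs_def)
      ultimately show ?thesis
        using Suc depth_Suc_iff[OF less.prems] depth_Suc_iff[OF gv[OF less.prems]] by simp
    qed
  qed
  then show ?thesis using v by blast
qed

text \<open>The same \<open>g\<close> serves all \<open>x\<close>, so it can move both ends of an
  edge inside a copy of \<open>H\<close>.\<close>

lemma exists_aut_Core: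
  assumes "graph_iso H H \<pi>" "a < d" "a' < d"
  shows "\<exists>g. graph_iso G G g \<and> (\<forall>x. g (Core x s a) = Core (\<pi> x) s' a')"
proof -
  have "graph_iso G G (lift_aut \<pi> (\<lambda>_. transpose a a') (s \<noteq> s'))"
    using assms by (intro graph_iso_lift_aut bij_betw_transpose_less)
  then show ?thesis by (intro exI conjI) auto
qed

lemma exists_aut_node:
  assumes "x \<in> vertices H" "a < d" "b < d" "x' \<in> vertices H" "a' < d" "b' < d"
  shows "\<exists>g. graph_iso G G g \<and> (\<forall>t \<le> Suc (2 * m).
    g (node x a b t) = node x' a' b' (if z then Suc (2 * m) - t else t))"
proof -
  obtain \<pi> where \<pi>: "graph_iso H H \<pi>" "\<pi> x = x'"
    using vertex_transitive assms by blast
  \<comment> \<open>Under reversal the end \<open>a\<close> on side \<open>False\<close> arrives on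
    side \<open>True\<close> and has to become \<open>b'\<close>; likewise \<open>b\<close> becomes
    \<open>a'\<close>.\<close>
  define \<sigma> where "\<sigma> s = (if s then transpose b (if z then a' else b') else transpose a (if z then b' else a'))" for s
  have "graph_iso G G (lift_aut \<pi> \<sigma> z)"
    using assms \<pi> by (intro graph_iso_lift_aut) (auto simp: \<sigma>_def intro!: bij_betw_transpose_less)
  then show ?thesis
    by (intro exI conjI) (auto simp: lift_aut_node \<pi> \<sigma>_def)
qed

lemma depth_le: "depth v \<le> m"
  by (cases v) (auto simp: min_def)

lemma aut_iff_depth:
  assumes "u \<in> vertices G" "v \<in> vertices G"
  shows "(\<exists>g. graph_iso G G g \<and> g u = v) \<longleftrightarrow> depth u = depth v"
proof
  assume "depth u = depth v"
  then consider (core) x s a x' s' a' where "u = Core x s a" "v = Core x' s' a'"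
    | (mid) x a b t x' a' b' t' where "u = Mid x a b t" "v = Mid x' a' b' t'"
        "t' = t \<or> t' = Suc (2 * m) - t"
    using assms by (cases u; cases v) (auto simp: min_def split: if_splits)
  then show "\<exists>g. graph_iso G G g \<and> g u = v"
  proof cases
    case core
    then obtain \<pi> where "graph_iso H H \<pi>" "\<pi> x = x'"
      using vertex_transitive[of x x'] assms by auto
    then show ?thesis using exists_aut_Core[of \<pi> a a' s s'] core assms by fastforce
  next
    case mid
    then have u: "u = node x a b t" "t \<le> Suc (2 * m)" and v: "v = node x' a' b' t'"
      using assms by (auto simp: node_def)
    have "x \<in> vertices H" "a < d" "b < d" "x' \<in> vertices H" "a' < d" "b' < d"
      using mid(1,2) assms by auto
    then obtain g where g: "graph_iso G G g" "\<And>s. s \<le> Suc (2 * m) \<Longrightarrow>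
        g (node x a b s) = node x' a' b' (if t' \<noteq> t then Suc (2 * m) - s else s)"
      using exists_aut_node[of x a b x' a' b' "t' \<noteq> t"] by blast
    have "g u = v" using g(2)[OF u(2)] u(1) v mid(3) by (cases "t' = t") auto
    with g(1) show ?thesis by blast
  qed
qed (use assms depth_invariant in auto)

lemma depth_image: "depth ` vertices G = {..m}"
proof
  show "{..m} \<subseteq> depth ` vertices G"
  proof
    fix c assume c: "c \<in> {..m}"
    obtain x where x: "x \<in> vertices H" using nonempty by blast
    have "is_vert (node x 0 0 c)" using x c d_ge by (intro is_vert_node) auto
    moreover have "depth (node x 0 0 c) = c" using c by (simp add: depth_node)
    ultimately show "c \<in> depth ` vertices G" by (metis imageI in_vertices_G)
  qed
qed (use depth_le in auto)

section \<open>Edge orbits\<close>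

lemma node_0: "node x a b 0 = Core x False a"
  by (simp add: node_def)

lemma node_last: "m = 0 \<Longrightarrow> node x a b (Suc 0) = Core x True b"
  unfolding node_def by simp

text \<open>Path edges are listed by increasing position. For \<open>m = 0\<close> an edge between
  the two sides is the path edge with \<open>t = 0\<close>, which keeps later arguments uniform in
  \<open>m\<close>.\<close>

lemma edge_G_cases:
  assumes "e \<in> edges G"
  obtains (core) x y s a where "{x, y} \<in> edges H" "a < d" "e = {Core x s a, Core y s a}"
  | (path) x a b t where "x \<in> vertices H" "a < d" "b < d" "t \<le> 2 * m"
      "e = {node x a b t, node x a b (Suc t)}"
proof -
  obtain u v where e: "e = {u, v}" and uv: "is_vert u" "is_vert v" "adj u v"
    using assms by (auto simp: G_def)
  have pathI: thesis if "v' = node x a b (Suc t)" "u' = node x a b t" "e = {u', v'}"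
      "x \<in> vertices H" "a < d" "b < d" "t \<le> 2 * m" for x a b t u' v'
    using path that by blast
  show thesis
  proof (cases u)
    case u: (Core x s a)
    show thesis
    proof (cases v)
      case v: (Core y s' a')
      show thesis
      proof (cases "{x, y} \<in> edges H \<and> s = s' \<and> a = a'")
        case True
        then show thesis using core[of x y a s] uv e u v by simp
      next
        case False
        have mem: "x \<in> vertices H" "a < d" "a' < d" using uv(1,2) u v by auto
        from False have *: "m = 0" "x = y" "s \<noteq> s'" using uv u v by auto
        show thesis
        proof (cases s)
          case True
          then have "u = node x a' a (Suc 0)" "v = node x a' a 0"
            using node_last[OF *(1), of x a' a] *(2,3) by (auto simp: u v node_0)
          then show thesis using mem e by (intro pathI[of u x a' a 0 v]) auto
        next
          case False
          then have "v = node x a a' (Suc 0)" "u = node x a a' 0"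
            using node_last[OF *(1), of x a a'] *(2,3) by (auto simp: u v node_0)
          then show thesis using mem e by (intro pathI[of v x a a' 0 u]) auto
        qed
      qed
    next
      case v: (Mid y b c t)
      show thesis
      proof (cases s)
        case True
        then show thesis
          using uv e by (intro pathI[of u y b c "2 * m" v]) (auto simp: u v node_def insert_commute)
      next
        case False
        then show thesis
          using uv e by (intro pathI[of v y b c 0 u]) (auto simp: u v node_def)
      qed
    qed
  next
    case u: (Mid y b c t)
    show thesis
    proof (cases v)
      case v: (Core x s a)
      show thesis
      proof (cases s)
        case True
        then show thesis
          using uv e by (intro pathI[of v y b c "2 * m" u]) (auto simp: u v node_def)
      next
        case False
        then show thesis
          using uv e by (intro pathI[of u y b c 0 v]) (auto simp: u v node_def insert_commute)
      qed
    next
      case v: (Mid y' b' c' t')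
      show thesis
      proof (cases "t' = Suc t")
        case True
        then show thesis
          using uv e by (intro pathI[of v y b c t u]) (auto simp: u v node_def)
      next
        case False
        then show thesis
          using uv e by (intro pathI[of u y b c t' v]) (auto simp: u v node_def insert_commute)
      qed
    qed
  qed
qed

text \<open>Ports keep \<open>x\<close> but leave the copy of \<open>H\<close>, while neighbours in
  \<open>H\<close> stay in it. Since \<open>x\<close> and \<open>y\<close> differ, a common
  neighbour must lie in the same copy.\<close>

lemma triangles_core:
  assumes e: "{x, y} \<in> edges H" and a: "a < d"
  shows "triangles G {Core x s a, Core y s a} = triangles H {x, y}"
proof -
  have "{w \<in> vertices G. \<forall>v \<in> {Core x s a, Core y s a}. {v, w} \<in> edges G} =
      (\<lambda>z. Core z s a) ` {w \<in> vertices H. \<forall>v \<in> {x, y}. {v, w} \<in> edges H}" (is "?L = ?R")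
  proof (rule Set.set_eqI)
    fix w show "w \<in> ?L \<longleftrightarrow> w \<in> ?R"
      using edge_H_vertices[OF e] edge_H_distinct[OF e] a by (cases w) (auto simp: image_iff)
  qed
  then show ?thesis by (simp add: triangles_def card_image inj_on_def)
qed

lemma no_common_neighbour:
  assumes t: "t \<le> 2 * m"
  shows "\<not> (adj (node x a b t) w \<and> adj (node x a b (Suc t)) w)"
proof (cases "m = 0")
  case True
  then have "node x a b t = Core x False a" "node x a b (Suc t) = Core x True b"
    unfolding node_def using t by simp_all
  then show ?thesis using edge_H_distinct[of x x] by (cases w) auto
next
  case False
  then show ?thesis
    using t edge_H_distinct[of x x] by (cases w) (auto simp: node_def split: if_splits)
qed

lemma triangles_path:
  assumes "t \<le> 2 * m"
  shows "triangles G {node x a b t, node x a b (Suc t)} = 0"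
proof -
  have "{w \<in> vertices G. \<forall>v \<in> {node x a b t, node x a b (Suc t)}. {v, w} \<in> edges G} = {}"
    using no_common_neighbour[OF assms, of x a b] by simp
  then show ?thesis by (simp only: triangles_def card.empty)
qed

text \<open>Depth locates a path edge up to reversal but is 0 on outermost path edges and on edges
  of copies of \<open>H\<close> alike. The triangle count separates these, being positive only on
  the latter, and also tells the directions apart.\<close>

definition edge_type :: "'w vert set \<Rightarrow> nat \<times> nat" where
  "edge_type e = (Min (depth ` e), triangles G e)"

lemma edge_type_core:
  assumes "{x, y} \<in> edges H" "a < d"
  shows "edge_type {Core x s a, Core y s a} = (0, triangles H {x, y})"
  using triangles_core[OF assms] by (simp add: edge_type_def)

text \<open>Reversal sends edge \<open>t\<close> to edge \<open>2 * m - t\<close> and fixes the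
  middle edge \<open>t = m\<close>.\<close>

lemma edge_type_path:
  assumes "t \<le> 2 * m"
  shows "edge_type {node x a b t, node x a b (Suc t)} = (min t (2 * m - t), 0)"
  using assms triangles_path[OF assms, of x a b] by (simp add: edge_type_def depth_node)

lemma aut_iff_edge_type:
  assumes d: "e \<in> edges G" and e: "e' \<in> edges G"
  shows "(\<exists>g. graph_iso G G g \<and> g ` e = e') \<longleftrightarrow> edge_type e = edge_type e'"
proof
  assume "\<exists>g. graph_iso G G g \<and> g ` e = e'"
  then obtain g where g: "graph_iso G G g" "g ` e = e'" by blast
  have "e \<subseteq> vertices G" using d simple_G by (simp add: simple_graph_def)
  then have "triangles G e' = triangles G e" "depth ` e' = depth ` e"
    using g triangles_iso[OF g(1)] depth_invariant[OF g(1)] by (force simp: image_image subset_iff)+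
  then show "edge_type e = edge_type e'" by (simp add: edge_type_def)
next
  assume eq: "edge_type e = edge_type e'"
  show "\<exists>g. graph_iso G G g \<and> g ` e = e'"
    using d
  proof (cases rule: edge_G_cases)
    case 1: (core x y s a)
    show ?thesis using e
    proof (cases rule: edge_G_cases)
      case 2: (core x' y' s' a')
      have "triangles H {x, y} = triangles H {x', y'}"
        using eq 1 2 by (simp add: edge_type_core)
      then obtain \<pi> where "graph_iso H H \<pi>" "\<pi> x = x'" "\<pi> y = y'"
        using arc_transitive 1 2 by blast
      then show ?thesis using exists_aut_Core[of \<pi> a a' s s'] 1 2 by force
    next
      case 2: (path x' a' b' t')
      then show ?thesis using eq 1 triangles_pos[of "{x, y}"] by (simp add: edge_type_core edge_type_path)
    qed
  next
    case 1: (path x a b t)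
    show ?thesis using e
    proof (cases rule: edge_G_cases)
      case 2: (core x' y' s' a')
      then show ?thesis using eq 1 triangles_pos[of "{x', y'}"] by (simp add: edge_type_core edge_type_path)
    next
      case 2: (path x' a' b' t')
      have t': "t' = t \<or> t' = 2 * m - t"
        using eq 1 2 by (auto simp: edge_type_path min_def split: if_splits)
      obtain g where g: "graph_iso G G g" "\<And>s. s \<le> Suc (2 * m) \<Longrightarrow>
          g (node x a b s) = node x' a' b' (if t' \<noteq> t then Suc (2 * m) - s else s)"
        using exists_aut_node[of x a b x' a' b' "t' \<noteq> t"] 1 2 by blast
      have "g ` e = e'"
      proof (cases "t' = t")
        case True
        then show ?thesis using 1 2 g(2) by simp
      next
        case False
        \<comment> \<open>Reversal acts on vertex positions by \<open>Suc (2 * m) - t\<close>, so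
          the lower end of the edge at \<open>t\<close> becomes the upper end of the edge at
          \<open>t'\<close>.\<close>
        then have "Suc (2 * m) - t = Suc t'" "Suc (2 * m) - Suc t = t'" using t' 1 by auto
        then show ?thesis using 1 2 g(2) False by (simp add: insert_commute)
      qed
      with g(1) show ?thesis by blast
    qed
  qed
qed

lemma edge_type_image:
  "edge_type ` edges G = Pair 0 ` triangles H ` edges H \<union> (\<lambda>i. (i, 0)) ` {..m}" (is "?L = ?R")
proof
  show "?L \<subseteq> ?R"
  proof (rule image_subsetI)
    fix e assume "e \<in> edges G"
    then show "edge_type e \<in> ?R"
      by (cases rule: edge_G_cases) (auto simp: edge_type_core edge_type_path)
  qed
  obtain x0 where x0: "x0 \<in> vertices H" using nonempty by blast
  show "?R \<subseteq> ?L"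
  proof safe
    fix e assume e: "e \<in> edges H"
    then obtain x y where xy: "e = {x, y}" by (rule simple_graph_edgeE[OF simple_H])
    then have "{Core x True 0, Core y True 0} \<in> edges G"
      using e edge_H_vertices[of x y] d_ge by auto
    then show "(0, triangles H e) \<in> ?L"
      using edge_type_core[of x y 0 True] e xy d_ge by (metis imageI less_le_trans zero_less_numeral)
  next
    fix i assume i: "i \<le> m"
    have "{node x0 0 0 i, node x0 0 0 (Suc i)} \<in> edges G"
      using i x0 d_ge by (auto intro!: is_vert_node adj_node)
    moreover have "edge_type {node x0 0 0 i, node x0 0 0 (Suc i)} = (i, 0)"
      using i by (subst edge_type_path) auto
    ultimately show "(i, 0) \<in> ?L" by (metis imageI)
  qed
qed

lemma card_edge_types: "card (edge_type ` edges G) = card (triangles H ` edges H) + Suc m"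
proof -
  have "finite (edges H)"
    using simple_H finite_subset[of "edges H" "Pow (vertices H)"] by (auto simp: simple_graph_def)
  moreover have "Pair 0 ` triangles H ` edges H \<inter> (\<lambda>i. (i, 0)) ` {..m} = {}"
    using triangles_pos by force
  ultimately show ?thesis
    unfolding edge_type_image by (subst card_Un_disjoint) (simp_all add: card_image inj_on_def)
qed

lemma card_G_ge: "d \<le> card (vertices G)"
proof -
  obtain x where "x \<in> vertices H" using nonempty by blast
  then have "Core x False ` {..<d} \<subseteq> vertices G" by auto
  then have "card (Core x False ` {..<d}) \<le> card (vertices G)"
    by (rule card_mono[OF finite_G])
  then show ?thesis by (simp add: card_image inj_on_def)
qed

lemma nut_graph_of_nat:
  "\<exists>K :: nat ugraph. (nut_graph K \<and> num_vertex_orbits K = Suc m \<and>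
     num_edge_orbits K = card (triangles H ` edges H) + Suc m) \<and>
     simple_graph K \<and> d \<le> card (vertices K)"
proof -
  obtain K :: "nat ugraph" and h where K: "simple_graph K" and h: "graph_iso G K h"
    using simple_graph_relabel_nat[OF simple_G] by blast
  have card: "card (vertices K) = card (vertices G)"
    using h by (auto simp: graph_iso_def dest: bij_betw_same_card)
  have "nut_graph K"
    using K card card_G_ge d_ge nut_fun_iso[OF h nut_weight] by (intro nut_graphI) auto
  moreover have "num_vertex_orbits K = Suc m"
    using num_vertex_orbits_eq[OF h aut_iff_depth] by (simp add: depth_image)
  moreover have "num_edge_orbits K = card (triangles H ` edges H) + Suc m"
    using num_edge_orbits_eq[OF simple_G K h aut_iff_edge_type] by (simp add: card_edge_types)
  ultimately show ?thesis using K card card_G_ge by auto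
qed

end

section \<open>Choice of the parameters\<close>

lemma (in hamming) threading: "threading H d"
proof (rule threading.intro)
  show "vertices H \<noteq> {}" by (simp add: W_nonempty)
  show "triangles H e > 0" if "e \<in> edges H" for e
  proof -
    have "triangles H e \<in> (\<lambda>i. n i - 2) ` {..<j}" using that triangles_image_H by blast
    then show ?thesis using n_ge by force
  qed
  show "card (nbrs H x) = d" if "x \<in> vertices H" for x
    using that card_nbrs_H by simp
  show "f x = 0" if "\<And>x. x \<in> vertices H \<Longrightarrow> (\<Sum>y \<in> nbrs H x. f y) = 0" "x \<in> vertices H"
    for f :: "_ \<Rightarrow> real" and x
    using H_nonsingular[of f x] that by simp
  show "f x = 0" if "\<And>x. x \<in> vertices H \<Longrightarrow> (\<Sum>y \<in> nbrs H x. f y) = - real d * f x" "x \<in> vertices H"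
    for f :: "_ \<Rightarrow> real" and x
    using H_min_eigenvalue[of f x] that by simp
  show "\<exists>c. \<forall>x \<in> vertices H. f x = c" if "\<And>x. x \<in> vertices H \<Longrightarrow> (\<Sum>y \<in> nbrs H x. f y) = real d * f x"
    for f :: "_ \<Rightarrow> real"
    using H_max_eigenvalue[of f] that by simp
  show "\<exists>\<pi>. graph_iso H H \<pi> \<and> \<pi> x = x'" if "x \<in> vertices H" "x' \<in> vertices H" for x x'
    using vertex_transitive_H that by simp
qed (use simple_H d_bounds arc_transitive_H in \<open>assumption | blast\<close>)+

lemma exists_nut_graph:
  assumes "r \<ge> 1" "k \<ge> r + 1"
  shows "\<exists>G :: nat ugraph. (nut_graph G \<and> num_vertex_orbits G = r \<and> num_edge_orbits G = k) \<and>
    simple_graph G \<and> card (vertices G) \<ge> N"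
proof -
  \<comment> \<open>The offset puts every size above \<open>k - r\<close> and at least at 4,
    \<open>i\<close> makes the sizes distinct, and \<open>N\<close> forces \<open>d \<ge> N\<close>
    and with it the order.\<close>
  interpret hamming "k - r" "\<lambda>i. N + (k - r) + 4 + i"
    using assms by unfold_locales (auto simp: inj_on_def)
  interpret T: threading H d "r - 1" by (rule threading)
  have "card (triangles H ` edges H) = k - r"
    unfolding triangles_image_H card_image[OF n_minus_inj] by simp
  then show ?thesis
    using T.nut_graph_of_nat d_bounds(3) assms by fastforce
qed

theorem theorem6:
  fixes r k :: nat
  assumes "r \<ge> 1" and "k \<ge> r + 1"
  shows "\<exists>\<G> :: nat ugraph set.
           infinite \<G> \<and>
           pairwise (\<lambda>G H. \<not> isomorphic G H) \<G> \<and>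
           (\<forall>G \<in> \<G>. nut_graph G \<and> num_vertex_orbits G = r \<and> num_edge_orbits G = k)"
  by (rule infinite_nonisomorphic_family) (rule exists_nut_graph[OF assms])

end
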